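(* $$|RAI_{2n}(1234)|=|AI_{2n}(4321)|=M_{n+1}-2M_{n-1}+M_{n-3},$$ where $M_k$ is the $k$-th Motzkin number.
   Context: Let $S_n$ be the set of permutations $\pi=\pi_1\ldots\pi_n$ of $\{1,\ldots,n\}$. A permutation is alternating if, for all $1\le i\le n-1$, $\pi_i<\pi_{i+1}$ if and only if $i$ is odd; it is reverse alternating if, for all $1\le i\le n-1$, $\pi_i>\pi_{i+1}$ if and only if $i$ is odd. $AI_n$ (resp. $RAI_n$) is the set of alternating (resp. reverse alternating) involutions ($\pi=\pi^{-1}$) in $S_n$. A permutation $\pi\in S_n$ avoids the pattern $\tau\in S_k$ if there are no indices $i_1<\cdots<i_k$ such that $\pi_{i_1}\ldots\pi_{i_k}$ is order-isomorphic to $\tau$; $AI_n(\tau)$ and $RAI_n(\tau)$ are the subsets of elements avoiding $\tau$. The Motzkin number $M_n$ is the number of Motzkin paths of length $n$, i.e. lattice paths from $(0,0)$ to $(n,0)$ with steps $U=(1,1)$, $D=(1,-1)$, $H=(1,0)$ that stay weakly above the $x$-axis (OEIS sequence A001006). *)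

theory Defs
  imports "HOL-Combinatorics.Permutations"
begin

text \<open>
  An element \<open>\<pi>\<^sub>1 \<dots> \<pi>\<^sub>n\<close> of \<open>S\<^sub>n\<close> is a function \<open>\<pi> :: nat \<Rightarrow> nat\<close> with
  \<open>\<pi> permutes {1..n}\<close>, hence the identity outside \<open>{1..n}\<close>; in particular \<open>inv \<pi>\<close> is the
  inverse permutation. Patterns are given in one-line notation, as lists.
\<close>

definition alternating :: "nat \<Rightarrow> (nat \<Rightarrow> nat) \<Rightarrow> bool" where
  "alternating n \<pi> \<longleftrightarrow> (\<forall>i. 1 \<le> i \<and> i < n \<longrightarrow> (\<pi> i < \<pi> (i + 1) \<longleftrightarrow> odd i))"

definition reverse_alternating :: "nat \<Rightarrow> (nat \<Rightarrow> nat) \<Rightarrow> bool" where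
  "reverse_alternating n \<pi> \<longleftrightarrow> (\<forall>i. 1 \<le> i \<and> i < n \<longrightarrow> (\<pi> i > \<pi> (i + 1) \<longleftrightarrow> odd i))"

text \<open>
  The map \<open>f\<close> lists the positions \<open>f 0 < f 1 < \<dots>\<close> of an occurrence of \<open>\<tau>\<close>
  (counted from 0 as in the list \<open>\<tau>\<close>, with values in \<open>{1..n}\<close>).
\<close>

definition avoids :: "nat \<Rightarrow> (nat \<Rightarrow> nat) \<Rightarrow> nat list \<Rightarrow> bool" where
  "avoids n \<pi> \<tau> \<longleftrightarrow>
     \<not> (\<exists>f. strict_mono_on {..<length \<tau>} f \<and> f ` {..<length \<tau>} \<subseteq> {1..n} \<and>
          (\<forall>a<length \<tau>. \<forall>b<length \<tau>. \<pi> (f a) < \<pi> (f b) \<longleftrightarrow> \<tau> ! a < \<tau> ! b))"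

definition AI :: "nat \<Rightarrow> (nat \<Rightarrow> nat) set" where
  "AI n = {\<pi>. \<pi> permutes {1..n} \<and> inv \<pi> = \<pi> \<and> alternating n \<pi>}"

definition RAI :: "nat \<Rightarrow> (nat \<Rightarrow> nat) set" where
  "RAI n = {\<pi>. \<pi> permutes {1..n} \<and> inv \<pi> = \<pi> \<and> reverse_alternating n \<pi>}"

definition AI_avoiding :: "nat \<Rightarrow> nat list \<Rightarrow> (nat \<Rightarrow> nat) set" where
  "AI_avoiding n \<tau> = {\<pi> \<in> AI n. avoids n \<pi> \<tau>}"

definition RAI_avoiding :: "nat \<Rightarrow> nat list \<Rightarrow> (nat \<Rightarrow> nat) set" where
  "RAI_avoiding n \<tau> = {\<pi> \<in> RAI n. avoids n \<pi> \<tau>}"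

datatype motzkin_step = Up | Down | Flat

fun rise :: "motzkin_step \<Rightarrow> int" where
  "rise Up = 1"
| "rise Down = -1"
| "rise Flat = 0"

definition height :: "motzkin_step list \<Rightarrow> int" where
  "height w = sum_list (map rise w)"

definition motzkin_path :: "motzkin_step list \<Rightarrow> bool" where
  "motzkin_path w \<longleftrightarrow> (\<forall>k\<le>length w. 0 \<le> height (take k w)) \<and> height w = 0"

text \<open>
  The index is an integer so that index subtraction does not truncate. There is no path of
  negative length, so the Motzkin numbers of negative index are 0.
\<close>

definition motzkin :: "int \<Rightarrow> nat" where
  "motzkin k = card {w. motzkin_path w \<and> int (length w) = k}"

end

theory Submission
  imports Defs "HOL-Library.Infinite_Set"
begin

text \<open>
  Words in the steps are compared through \<open>Up < Flat < Down\<close>. A 4321-avoiding involution is one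
  whose 2-cycles are pairwise nonnesting; recording excedances, fixed points and deficiencies as
  \<open>Up\<close>, \<open>Flat\<close>, \<open>Down\<close> turns it into an arbitrary Motzkin path, and \<open>i\<close> is a descent exactly if the
  letter increases from position \<open>i\<close> to \<open>i + 1\<close>. A 1234-avoiding involution corresponds by
  Robinson-Schensted to a standard Young tableau with at most three columns, and recording the
  column of each entry gives a ballot word, in which \<open>i\<close> is a descent exactly if the letter does
  not increase. Hence both sets are in bijection with words whose consecutive letters satisfy the
  same condition, namely a first letter, \<open>n - 1\<close> increasing pairs and a last letter.

  The increasing pairs \<open>Up Flat\<close>, \<open>Up Down\<close>, \<open>Flat Down\<close> move a Motzkin path by \<open>1\<close>, \<open>0\<close>, \<open>-1\<close>, so
  they again form a Motzkin path, and similarly for ballot words. Finally, the number of ballot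
  words starting at height differences \<open>(x, y)\<close> is the sum, over \<open>i \<le> x\<close> and \<open>j \<le> y\<close>, of the
  numbers of Motzkin paths of the same length that start at height \<open>i + j\<close>; this is the branching
  rule from SU(3) to SU(2).
\<close>

fun level :: "motzkin_step \<Rightarrow> nat" where
  "level Up = 0"
| "level Flat = 1"
| "level Down = 2"

text \<open>List positions count from 0 and permutation positions from 1, so \<open>odd i\<close>
  marks the even positions: the descents of an alternating permutation, the ascents of a reverse
  alternating one.\<close>

definition zigzag :: "motzkin_step list \<Rightarrow> bool" where
  "zigzag w \<longleftrightarrow> (\<forall>i. Suc i < length w \<longrightarrow> (level (w ! i) < level (w ! Suc i) \<longleftrightarrow> odd i))"

lemma inv_eq_self_iff:
  assumes "\<pi> permutes S"
  shows "inv \<pi> = \<pi> \<longleftrightarrow> (\<forall>p. \<pi> (\<pi> p) = p)"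
  using permutes_inverses[OF assms] by (metis ext)

subsection \<open>Nonnesting involutions and Motzkin paths\<close>

definition step_of :: "(nat \<Rightarrow> nat) \<Rightarrow> nat \<Rightarrow> motzkin_step" where
  "step_of \<pi> p = (if p < \<pi> p then Up else if \<pi> p = p then Flat else Down)"

definition word_of :: "nat \<Rightarrow> (nat \<Rightarrow> nat) \<Rightarrow> motzkin_step list" where
  "word_of N \<pi> = map (step_of \<pi>) [1..<Suc N]"

text \<open>Only the opening ends of 2-cycles are compared. A fixed point inside a 2-cycle is
  allowed, since it yields the pattern 321 but not 4321.\<close>

definition nonnesting :: "(nat \<Rightarrow> nat) \<Rightarrow> bool" where
  "nonnesting \<pi> \<longleftrightarrow> (\<forall>p q. p < q \<and> p < \<pi> p \<and> q < \<pi> q \<longrightarrow> \<pi> p < \<pi> q)"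

lemma length_word_of [simp]: "length (word_of N \<pi>) = N"
  by (simp add: word_of_def)

lemma nth_word_of: "i < N \<Longrightarrow> word_of N \<pi> ! i = step_of \<pi> (Suc i)"
  by (simp add: word_of_def nth_append del: upt_Suc)

text \<open>Nonnesting keeps two excedances from forming an inversion, and likewise two
  deficiencies, whose images are excedances. In the remaining cases the inequalities themselves
  order the letters.\<close>

lemma level_less_of_inversion:
  assumes "nonnesting \<pi>" and inv: "\<And>p. \<pi> (\<pi> p) = p" and "p < q" "\<pi> q < \<pi> p"
  shows "level (step_of \<pi> p) < level (step_of \<pi> q)"
proof -
  have "\<not> (p < \<pi> p \<and> q < \<pi> q)"
    using assms unfolding nonnesting_def by (meson less_asym)
  moreover have "\<not> (\<pi> p < p \<and> \<pi> q < q)"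
  proof
    assume "\<pi> p < p \<and> \<pi> q < q"
    then have "\<pi> (\<pi> q) < \<pi> (\<pi> p)"
      using assms(1)[unfolded nonnesting_def, rule_format, of "\<pi> q" "\<pi> p"] assms(4) by (simp add: inv)
    with \<open>p < q\<close> show False by (simp add: inv)
  qed
  ultimately show ?thesis
    using assms(3,4) by (auto simp: step_of_def)
qed

text \<open>The converse uses adjacency: if the letter increases, there is no room between
  \<open>p\<close> and \<open>Suc p\<close>, so \<open>\<pi> (Suc p) \<le> \<pi> p\<close>, and
  injectivity makes this strict.\<close>

lemma descent_iff_level_less:
  assumes "nonnesting \<pi>" and inv: "\<And>p. \<pi> (\<pi> p) = p"
  shows "\<pi> (Suc p) < \<pi> p \<longleftrightarrow> level (step_of \<pi> p) < level (step_of \<pi> (Suc p))"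
proof
  assume less: "level (step_of \<pi> p) < level (step_of \<pi> (Suc p))"
  have "\<pi> p \<noteq> \<pi> (Suc p)"
    using inv by (metis n_not_Suc_n)
  then show "\<pi> (Suc p) < \<pi> p"
    using less by (auto simp: step_of_def split: if_splits)
qed (use level_less_of_inversion[OF assms, of p "Suc p"] in simp)

text \<open>Along an occurrence of 4321 the letters would increase strictly three times, but there
  are only three letters. Conversely, the four ends of two nested 2-cycles form an
  occurrence.\<close>

lemma avoids_decreasing_iff:
  assumes "\<pi> permutes {1..N}" and inv: "\<And>p. \<pi> (\<pi> p) = p"
  shows "avoids N \<pi> [4, 3, 2, 1] \<longleftrightarrow> nonnesting \<pi>"
proof -
  have nth: "[4, 3, 2, 1 :: nat] ! a < [4, 3, 2, 1] ! b \<longleftrightarrow> b < a" if "a < 4" "b < 4" for a b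
    using that by (auto simp: less_Suc_eq numeral_eq_Suc)
  have len: "length [4, 3, 2, 1 :: nat] = 4" by simp
  have "(\<forall>a<4. \<forall>b<4. \<pi> (f a) < \<pi> (f b) \<longleftrightarrow> [4, 3, 2, 1 :: nat] ! a < [4, 3, 2, 1] ! b)
      \<longleftrightarrow> (\<forall>a<4. \<forall>b<4. \<pi> (f a) < \<pi> (f b) \<longleftrightarrow> b < a)" for f
    using nth by blast
  then have avoids: "avoids N \<pi> [4, 3, 2, 1] \<longleftrightarrow> \<not> (\<exists>f. strict_mono_on {..<4 :: nat} f \<and> f ` {..<4} \<subseteq> {1..N} \<and>
      (\<forall>a<4. \<forall>b<4. \<pi> (f a) < \<pi> (f b) \<longleftrightarrow> b < a))" (is "_ \<longleftrightarrow> \<not> (\<exists>f. ?P f)")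
    by (simp only: avoids_def len)
  have "(\<exists>f. ?P f) \<longleftrightarrow> \<not> nonnesting \<pi>"
  proof
    assume "\<exists>f. ?P f"
    then obtain f where f: "?P f" ..
    show "\<not> nonnesting \<pi>"
    proof
      assume "nonnesting \<pi>"
      then have less: "level (step_of \<pi> (f a)) < level (step_of \<pi> (f (Suc a)))" if "Suc a < 4" for a
        using f that strict_mono_onD[of "{..<4 :: nat}" f a "Suc a"]
        by (intro level_less_of_inversion) (simp_all add: inv)
      have "level (step_of \<pi> (f 3)) \<le> 2"
        by (cases "step_of \<pi> (f 3)") auto
      with less[of 0] less[of 1] less[of 2] show False
        by (simp add: numeral_eq_Suc)
    qed
  next
    assume "\<not> nonnesting \<pi>"
    then obtain p q where pq: "p < q" "p < \<pi> p" "q < \<pi> q" "\<not> \<pi> p < \<pi> q"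
      unfolding nonnesting_def by blast
    moreover have "\<pi> p \<noteq> \<pi> q"
      using inv pq(1) by (metis less_irrefl)
    ultimately have less: "p < q" "q < \<pi> q" "\<pi> q < \<pi> p" by auto
    have "p \<in> {1..N}" "q \<in> {1..N}"
      using permutes_not_in[OF assms(1), of p] permutes_not_in[OF assms(1), of q] pq by auto
    then have range: "p \<in> {1..N}" "q \<in> {1..N}" "\<pi> p \<in> {1..N}" "\<pi> q \<in> {1..N}"
      using permutes_in_image[OF assms(1)] by auto
    define f where "f = (!) [p, q, \<pi> q, \<pi> p]"
    have f: "f 0 = p" "f (Suc 0) = q" "f (Suc (Suc 0)) = \<pi> q" "f (Suc (Suc (Suc 0))) = \<pi> p"
      by (simp_all add: f_def)
    have "strict_mono_on {..<4 :: nat} f"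
      by (rule strict_mono_onI) (use less in \<open>auto simp: numeral_eq_Suc less_Suc_eq f\<close>)
    moreover have "f ` {..<4} \<subseteq> {1..N}"
      using range by (auto simp: numeral_eq_Suc less_Suc_eq f simp del: atLeastAtMost_iff)
    moreover have "\<forall>a<4. \<forall>b<4. \<pi> (f a) < \<pi> (f b) \<longleftrightarrow> b < a"
      using less by (auto simp: numeral_eq_Suc less_Suc_eq f inv)
    ultimately show "\<exists>f. ?P f" by blast
  qed
  then show ?thesis by (simp only: avoids not_not)
qed

lemma alternating_iff_zigzag:
  assumes "nonnesting \<pi>" and inv: "\<And>p. \<pi> (\<pi> p) = p"
  shows "alternating N \<pi> \<longleftrightarrow> zigzag (word_of N \<pi>)"
proof -
  have ne: "\<pi> p \<noteq> \<pi> (Suc p)" for p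
    using inv by (metis n_not_Suc_n)
  have "alternating N \<pi> \<longleftrightarrow> (\<forall>i. Suc i < N \<longrightarrow> (\<pi> (Suc i) < \<pi> (Suc (Suc i)) \<longleftrightarrow> even i))"
    unfolding alternating_def by (metis Suc_eq_plus1 Suc_le_D Suc_le_mono One_nat_def le0 even_Suc)
  also have "\<dots> \<longleftrightarrow> (\<forall>i. Suc i < N \<longrightarrow> (\<pi> (Suc (Suc i)) < \<pi> (Suc i) \<longleftrightarrow> odd i))"
    using ne by (metis linorder_neqE_nat less_asym)
  finally show ?thesis
    by (simp add: zigzag_def nth_word_of descent_iff_level_less[OF assms])
qed

section \<open>Motzkin paths through prefix counts of letters\<close>

definition positions :: "motzkin_step list \<Rightarrow> nat \<Rightarrow> motzkin_step \<Rightarrow> nat set" where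
  "positions w k a = {p \<in> {1..k}. w ! (p - 1) = a}"

lemma finite_positions [simp]: "finite (positions w k a)"
  by (simp add: positions_def)

lemma height_take:
  "k \<le> length w \<Longrightarrow> height (take k w) = int (card (positions w k Up)) - int (card (positions w k Down))"
proof (induction k)
  case 0
  then show ?case by (simp add: height_def positions_def)
next
  case (Suc k)
  have "positions w (Suc k) a = (if w ! k = a then insert (Suc k) (positions w k a) else positions w k a)" for a
    by (auto simp: positions_def le_Suc_eq)
  moreover have "Suc k \<notin> positions w k a" for a
    by (simp add: positions_def)
  ultimately have "int (card (positions w (Suc k) a)) = int (card (positions w k a)) + of_bool (w ! k = a)" for a
    by simp
  moreover have "height (take (Suc k) w) = height (take k w) + rise (w ! k)"
    using Suc.prems by (simp add: take_Suc_conv_app_nth height_def)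
  ultimately show ?case
    using Suc by (cases "w ! k") auto
qed

lemma motzkin_path_iff_positions:
  "motzkin_path w \<longleftrightarrow> (\<forall>k\<le>length w. card (positions w k Down) \<le> card (positions w k Up)) \<and>
     card (positions w (length w) Down) = card (positions w (length w) Up)"
  using height_take[of "length w" w] by (auto simp: motzkin_path_def height_take)

lemma positions_word_of:
  assumes "k \<le> N"
  shows "positions (word_of N \<pi>) k Up = {p \<in> {1..k}. p < \<pi> p}"
    and "positions (word_of N \<pi>) k Down = {p \<in> {1..k}. \<pi> p < p}"
proof -
  have "word_of N \<pi> ! (p - 1) = step_of \<pi> p" if "p \<in> {1..k}" for p
  proof -
    have "p - 1 < N" "Suc (p - 1) = p" using that assms by auto
    then show ?thesis using nth_word_of[of "p - 1" N \<pi>] by simp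
  qed
  then show "positions (word_of N \<pi>) k Up = {p \<in> {1..k}. p < \<pi> p}"
    and "positions (word_of N \<pi>) k Down = {p \<in> {1..k}. \<pi> p < p}"
    by (auto simp: positions_def step_of_def split: if_splits)
qed

text \<open>An involution sends the deficiencies in \<open>{1..k}\<close> injectively to excedances
  in \<open>{1..k}\<close>, which bounds every prefix. At \<open>k = N\<close> it also sends
  excedances to deficiencies.\<close>

lemma motzkin_path_word_of:
  assumes "\<pi> permutes {1..N}" and inv: "\<And>p. \<pi> (\<pi> p) = p"
  shows "motzkin_path (word_of N \<pi>)"
proof -
  have range: "\<pi> p \<in> {1..N} \<longleftrightarrow> p \<in> {1..N}" for p
    by (rule permutes_in_image[OF assms(1)])
  have inj: "inj_on \<pi> A" for A
    using permutes_inj[OF assms(1)] by (rule inj_on_subset) simp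
  have le: "card {p \<in> {1..k}. \<pi> p < p} \<le> card {p \<in> {1..k}. p < \<pi> p}" if "k \<le> N" for k
    by (rule card_inj_on_le[where f = \<pi>, OF inj]) (use range that in \<open>fastforce simp: inv\<close>)+
  moreover have "card {p \<in> {1..N}. p < \<pi> p} \<le> card {p \<in> {1..N}. \<pi> p < p}"
    by (rule card_inj_on_le[where f = \<pi>, OF inj]) (use range in \<open>fastforce simp: inv\<close>)+
  ultimately show ?thesis
    unfolding motzkin_path_iff_positions by (auto simp: positions_word_of intro: antisym)
qed

text \<open>At the least point where the maps differ, the smaller value is taken by the other map at
  an earlier point. There both maps agree, against strict monotonicity.\<close>

lemma strict_mono_on_eqI:
  fixes f g :: "'a :: wellorder \<Rightarrow> 'b :: linorder"
  assumes "strict_mono_on A f" "strict_mono_on A g" "f ` A = g ` A" "x \<in> A"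
  shows "f x = g x"
  using \<open>x \<in> A\<close>
proof (induction x rule: less_induct)
  case (less x)
  have False if hk: "strict_mono_on A h" "strict_mono_on A k" "h ` A = k ` A" "h x < k x"
    "\<And>y. y < x \<Longrightarrow> y \<in> A \<Longrightarrow> h y = k y" for h k :: "'a \<Rightarrow> 'b"
  proof -
    obtain y where y: "y \<in> A" "h x = k y"
      using hk(3) less.prems by blast
    then have "y < x"
      using hk(2,4) less.prems by (metis strict_mono_on_less)
    then have "h y < h x"
      using hk(1) y(1) less.prems by (metis strict_mono_onD)
    then show False
      using hk(5) y \<open>y < x\<close> by simp
  qed
  from this[of f g] this[of g f] show ?case
    using assms(1-3) less.IH by (metis linorder_neqE)
qed

text \<open>The word determines the set of excedances and its image, the set of deficiencies.
  Nonnesting makes the map between them increasing, which leaves one choice.\<close>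

lemma word_of_inject:
  assumes "\<pi> permutes {1..N}" "\<sigma> permutes {1..N}" and inv: "\<And>p. \<pi> (\<pi> p) = p" "\<And>p. \<sigma> (\<sigma> p) = p"
    and "nonnesting \<pi>" "nonnesting \<sigma>" and eq: "word_of N \<pi> = word_of N \<sigma>"
  shows "\<pi> = \<sigma>"
proof -
  have image: "\<tau> ` {p. p < \<tau> p} = {p. \<tau> p < p}" if "\<And>p. \<tau> (\<tau> p) = p" for \<tau> :: "nat \<Rightarrow> nat"
    using that by (auto simp: image_iff) (metis)
  have step: "step_of \<pi> p = step_of \<sigma> p" for p
  proof (cases "p \<in> {1..N}")
    case True
    then show ?thesis
      using nth_word_of[of "p - 1" N \<pi>] nth_word_of[of "p - 1" N \<sigma>] eq by auto
  next
    case False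
    then show ?thesis
      using permutes_not_in[OF assms(1)] permutes_not_in[OF assms(2)] by (simp add: step_of_def)
  qed
  have Up: "p < \<pi> p \<longleftrightarrow> p < \<sigma> p" and Down: "\<pi> p < p \<longleftrightarrow> \<sigma> p < p" for p
    using step[of p] by (auto simp: step_of_def split: if_splits)
  have up: "\<pi> p = \<sigma> p" if "p < \<pi> p" for p
  proof (rule strict_mono_on_eqI[where A = "{p. p < \<pi> p}" and f = \<pi> and g = \<sigma>])
    show "strict_mono_on {p. p < \<pi> p} \<pi>"
      using assms(5) by (auto simp: nonnesting_def intro: strict_mono_onI)
    show "strict_mono_on {p. p < \<pi> p} \<sigma>"
      using assms(6) by (auto simp: nonnesting_def Up intro: strict_mono_onI)
    show "\<pi> ` {p. p < \<pi> p} = \<sigma> ` {p. p < \<pi> p}"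
      using image[of \<pi>] image[of \<sigma>] inv Up Down by simp
  qed (use that in simp)
  show ?thesis
  proof
    fix p
    consider "p < \<pi> p" | "\<pi> p = p" | "\<pi> p < p" by linarith
    then show "\<pi> p = \<sigma> p"
    proof cases
      case 2
      then show ?thesis using Up[of p] Down[of p] by simp
    next
      case 3
      then have "\<pi> (\<pi> p) = \<sigma> (\<pi> p)"
        using inv by (intro up) simp
      then show ?thesis using inv by metis
    qed (rule up)
  qed
qed

text \<open>The i-th \<open>Up\<close> is matched with the i-th \<open>Down\<close>. An increasing
  matching is nonnesting, and the path condition puts every \<open>Up\<close> before its
  partner.\<close>

lemma ex_nonnesting_involution:
  assumes "motzkin_path w" "length w = N"
  shows "\<exists>\<pi>. \<pi> permutes {1..N} \<and> (\<forall>p. \<pi> (\<pi> p) = p) \<and> nonnesting \<pi> \<and> word_of N \<pi> = w"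
proof -
  define A where "A = positions w N Up"
  define C where "C = positions w N Down"
  have card: "card A = card C" and ballot: "\<And>k. k \<le> N \<Longrightarrow> card (positions w k Down) \<le> card (positions w k Up)"
    using assms by (auto simp: motzkin_path_iff_positions A_def C_def)
  have fin: "finite A" "finite C" by (simp_all add: A_def C_def)
  have disj: "A \<inter> C = {}" and sub: "A \<subseteq> {1..N}" "C \<subseteq> {1..N}"
    by (auto simp: A_def C_def positions_def)
  obtain g where g: "bij_betw g {..<card A} A" "strict_mono_on {..<card A} g"
    using ex_bij_betw_strict_mono_card[OF fin(1)] by blast
  obtain h where h: "bij_betw h {..<card A} C" "strict_mono_on {..<card A} h"
    using ex_bij_betw_strict_mono_card[OF fin(2)] card by metis
  define f where "f = h \<circ> inv_into {..<card A} g"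
  have bij: "bij_betw f A C"
    unfolding f_def by (rule bij_betw_trans[OF bij_betw_inv_into[OF g(1)] h(1)])
  have mono: "strict_mono_on A f"
  proof (rule strict_mono_onI)
    fix p q assume pq: "p \<in> A" "q \<in> A" "p < q"
    let ?i = "inv_into {..<card A} g"
    have "g (?i p) = p" "g (?i q) = q" "?i p \<in> {..<card A}" "?i q \<in> {..<card A}"
      using pq bij_betw_inv_into_right[OF g(1)] bij_betwE[OF bij_betw_inv_into[OF g(1)]] by auto
    then have "?i p < ?i q"
      using strict_mono_on_less[OF g(2)] pq(3) by metis
    with \<open>?i p \<in> _\<close> \<open>?i q \<in> _\<close> show "f p < f q"
      using strict_mono_onD[OF h(2)] by (simp add: f_def)
  qed
  have fC: "f p \<in> C" if "p \<in> A" for p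
    using bij_betwE[OF bij] that by blast
  have less_f: "p < f p" if p: "p \<in> A" for p
  \<comment> \<open>Otherwise the prefix of length \<open>f p\<close> contains the partners of all
    \<open>Up\<close> positions up to \<open>p\<close> but not \<open>p\<close> itself, so
    \<open>Down\<close> letters outnumber \<open>Up\<close> letters in it.\<close>
  proof (rule ccontr)
    assume "\<not> p < f p"
    moreover have "f p \<noteq> p" using fC[OF p] p disj by auto
    ultimately have "f p < p" by simp
    have "f p \<le> N" using fC[OF p] sub by auto
    have "f ` {q \<in> A. q \<le> p} = positions w (f p) Down"
    proof -
      have "positions w (f p) Down = {c \<in> C. c \<le> f p}"
        using \<open>f p \<le> N\<close> by (auto simp: positions_def C_def)
      also have "\<dots> = f ` {q \<in> A. q \<le> p}"
        using bij_betw_imp_surj_on[OF bij] strict_mono_on_less_eq[OF mono] p by auto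
      finally show ?thesis ..
    qed
    then have "card (positions w (f p) Down) = card {q \<in> A. q \<le> p}"
      using card_image[of f "{q \<in> A. q \<le> p}"] bij_betw_imp_inj_on[OF bij]
      by (metis (no_types, lifting) inj_on_subset mem_Collect_eq subsetI)
    moreover have "card (positions w (f p) Up) < card {q \<in> A. q \<le> p}"
    proof (rule psubset_card_mono)
      have "positions w (f p) Up \<subseteq> {q \<in> A. q \<le> p}"
        using \<open>f p \<le> N\<close> \<open>f p < p\<close> by (auto simp: positions_def A_def)
      moreover have "p \<notin> positions w (f p) Up"
        using \<open>f p < p\<close> by (simp add: positions_def)
      ultimately show "positions w (f p) Up \<subset> {q \<in> A. q \<le> p}"
        using p by blast
    qed (use fin in simp)
    ultimately show False
      using ballot[OF \<open>f p \<le> N\<close>] by simp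
  qed
  let ?f' = "inv_into A f"
  have f': "?f' c \<in> A" "f (?f' c) = c" if "c \<in> C" for c
    using bij_betwE[OF bij_betw_inv_into[OF bij]] bij_betw_inv_into_right[OF bij] that by auto
  have f'_f: "?f' (f p) = p" if "p \<in> A" for p
    by (rule bij_betw_inv_into_left[OF bij that])
  define \<pi> where "\<pi> p = (if p \<in> A then f p else if p \<in> C then ?f' p else p)" for p
  have inv: "\<pi> (\<pi> p) = p" for p
    using fC f' f'_f disj by (auto simp: \<pi>_def)
  have up: "p < \<pi> p \<longleftrightarrow> p \<in> A" and down: "\<pi> p < p \<longleftrightarrow> p \<in> C" for p
    using less_f[of p] less_f[of "?f' p"] f'[of p] disj by (auto simp: \<pi>_def)
  have "\<pi> permutes {1..N}"
    unfolding permutes_def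
  proof (intro conjI allI impI)
    show "\<exists>!p. \<pi> p = q" for q
      using inv by metis
  qed (use sub in \<open>auto simp: \<pi>_def\<close>)
  moreover have "nonnesting \<pi>"
    unfolding nonnesting_def using strict_mono_onD[OF mono] by (auto simp: up) (simp add: \<pi>_def)
  moreover have "word_of N \<pi> = w"
  proof (rule nth_equalityI)
    fix i assume "i < length (word_of N \<pi>)"
    then have i: "i < N" by simp
    then have "Suc i \<in> A \<longleftrightarrow> w ! i = Up" "Suc i \<in> C \<longleftrightarrow> w ! i = Down"
      by (auto simp: A_def C_def positions_def)
    then have "step_of \<pi> (Suc i) = w ! i"
      using up[of "Suc i"] down[of "Suc i"] by (cases "w ! i") (auto simp: step_of_def)
    then show "word_of N \<pi> ! i = w ! i"
      using i by (simp add: nth_word_of)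
  qed (use assms in simp)
  ultimately show ?thesis using inv by blast
qed

lemma card_AI_avoiding:
  "card (AI_avoiding N [4, 3, 2, 1]) = card {w. length w = N \<and> motzkin_path w \<and> zigzag w}"
proof -
  let ?A = "AI_avoiding N [4, 3, 2, 1]"
  have A: "\<pi> \<in> ?A \<longleftrightarrow> \<pi> permutes {1..N} \<and> (\<forall>p. \<pi> (\<pi> p) = p) \<and> nonnesting \<pi> \<and> zigzag (word_of N \<pi>)" for \<pi>
    using avoids_decreasing_iff[of \<pi> N] alternating_iff_zigzag[of \<pi> N] inv_eq_self_iff[of \<pi> "{1..N}"]
    unfolding AI_avoiding_def AI_def mem_Collect_eq by blast
  have "bij_betw (word_of N) ?A {w. length w = N \<and> motzkin_path w \<and> zigzag w}"
    unfolding bij_betw_def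
  proof (intro conjI inj_onI equalityI image_subsetI subsetI)
    fix \<pi> \<sigma> assume "\<pi> \<in> ?A" "\<sigma> \<in> ?A" "word_of N \<pi> = word_of N \<sigma>"
    then show "\<pi> = \<sigma>"
      using word_of_inject[of \<pi> N \<sigma>] unfolding A by blast
  next
    fix \<pi> assume "\<pi> \<in> ?A"
    then show "word_of N \<pi> \<in> {w. length w = N \<and> motzkin_path w \<and> zigzag w}"
      using motzkin_path_word_of[of \<pi> N] unfolding A by simp
  next
    fix w assume "w \<in> {w. length w = N \<and> motzkin_path w \<and> zigzag w}"
    then obtain \<pi> where "\<pi> permutes {1..N}" "\<forall>p. \<pi> (\<pi> p) = p" "nonnesting \<pi>" "word_of N \<pi> = w" "zigzag w"
      using ex_nonnesting_involution[of w N] by blast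
    then show "w \<in> word_of N ` ?A"
      using A[of \<pi>] by blast
  qed
  then show ?thesis by (rule bij_betw_same_card)
qed

subsection \<open>Growth diagrams\<close>

text \<open>
  A partition is a function from row indices, counted from 0, to row lengths; \<open>growth X i j\<close> is the
  shape of the tableaux that Robinson-Schensted-Knuth assigns to the submatrix of \<open>X\<close> with rows
  \<open>1, \<dots>, i\<close> and columns \<open>1, \<dots>, j\<close>. Fomin's local rule is used in its tropical form, which can be
  solved for \<open>\<alpha>\<close> and \<open>x\<close> without case distinctions.
\<close>

definition interlaces :: "(nat \<Rightarrow> int) \<Rightarrow> (nat \<Rightarrow> int) \<Rightarrow> bool" where
  "interlaces \<alpha> \<beta> \<longleftrightarrow> (\<forall>r. \<alpha> r \<le> \<beta> r \<and> \<beta> (Suc r) \<le> \<alpha> r)"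

definition local_rule :: "int \<Rightarrow> (nat \<Rightarrow> int) \<Rightarrow> (nat \<Rightarrow> int) \<Rightarrow> (nat \<Rightarrow> int) \<Rightarrow> nat \<Rightarrow> int" where
  "local_rule x \<alpha> \<beta> \<beta>' r =
     max (\<beta> r) (\<beta>' r) + (case r of 0 \<Rightarrow> x | Suc q \<Rightarrow> min (\<beta> q) (\<beta>' q) - \<alpha> q)"

fun growth :: "(nat \<Rightarrow> nat \<Rightarrow> int) \<Rightarrow> nat \<Rightarrow> nat \<Rightarrow> nat \<Rightarrow> int" where
  "growth X 0 j = (\<lambda>r. 0)"
| "growth X (Suc i) 0 = (\<lambda>r. 0)"
| "growth X (Suc i) (Suc j) =
     local_rule (X (Suc i) (Suc j)) (growth X i j) (growth X i (Suc j)) (growth X (Suc i) j)"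

definition add_box :: "nat \<Rightarrow> (nat \<Rightarrow> int) \<Rightarrow> nat \<Rightarrow> int" where
  "add_box r \<alpha> = \<alpha>(r := \<alpha> r + 1)"

text \<open>Row \<open>Suc r\<close> exceeds the larger of \<open>\<beta> (Suc r)\<close> and
  \<open>\<beta>' (Suc r)\<close> by the nonnegative
  \<open>min (\<beta> r) (\<beta>' r) - \<alpha> r\<close>. As those two are at most
  \<open>\<alpha> r\<close>, the result is at most
  \<open>min (\<beta> r) (\<beta>' r)\<close>.\<close>

lemma interlaces_local_rule:
  assumes "interlaces \<alpha> \<beta>" "interlaces \<alpha> \<beta>'" "0 \<le> x"
  shows "interlaces \<beta> (local_rule x \<alpha> \<beta> \<beta>')" "interlaces \<beta>' (local_rule x \<alpha> \<beta> \<beta>')"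
proof -
  have "\<alpha> r \<le> \<beta> r" "\<alpha> r \<le> \<beta>' r" "\<beta> (Suc r) \<le> \<alpha> r" "\<beta>' (Suc r) \<le> \<alpha> r" for r
    using assms(1,2) by (auto simp: interlaces_def)
  then show "interlaces \<beta> (local_rule x \<alpha> \<beta> \<beta>')" "interlaces \<beta>' (local_rule x \<alpha> \<beta> \<beta>')"
    using assms(3) unfolding interlaces_def local_rule_def
    by (auto split: nat.split simp: max_def min_def) (smt (verit))+
qed

lemma local_rule_inverse:
  assumes "\<gamma> = local_rule x \<alpha> \<beta> \<beta>'"
  shows "\<alpha> r = min (\<beta> r) (\<beta>' r) + max (\<beta> (Suc r)) (\<beta>' (Suc r)) - \<gamma> (Suc r)"
    and "x = \<gamma> 0 - max (\<beta> 0) (\<beta>' 0)"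
  by (simp_all add: assms local_rule_def)

lemma growth_0 [simp]: "growth X i 0 = (\<lambda>r. 0)"
  by (cases i) auto

lemma interlaces_0: "interlaces (\<lambda>r. 0) (\<lambda>r. 0)"
  by (simp add: interlaces_def)

text \<open>The two directions feed each other: interlacing along line \<open>i\<close> gives
  interlacing between lines \<open>i\<close> and \<open>Suc i\<close>, and this gives interlacing
  along line \<open>Suc i\<close>.\<close>

lemma growth_interlaces:
  assumes X: "\<And>p q. 0 \<le> X p q"
  shows "interlaces (growth X i j) (growth X i (Suc j))"
    and "interlaces (growth X i j) (growth X (Suc i) j)"
proof -
  have step: "interlaces (growth X i j) (growth X (Suc i) j)"
    if B: "\<And>j. interlaces (growth X i j) (growth X i (Suc j))" for i j
  proof (induction j)
    case 0
    show ?case by (simp add: interlaces_0)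
  next
    case (Suc j)
    then show ?case using interlaces_local_rule(1)[OF B Suc X] by simp
  qed
  have B: "interlaces (growth X i j) (growth X i (Suc j))" for i j
  proof (induction i arbitrary: j)
    case 0
    show ?case by (simp add: interlaces_0)
  next
    case (Suc i)
    show ?case using interlaces_local_rule(2)[OF Suc step[OF Suc] X] by simp
  qed
  show "interlaces (growth X i j) (growth X i (Suc j))" by (rule B)
  show "interlaces (growth X i j) (growth X (Suc i) j)" by (rule step[OF B])
qed

lemma growth_mono:
  assumes X: "\<And>p q. 0 \<le> X p q" and "i \<le> i'" "j \<le> j'"
  shows "growth X i j r \<le> growth X i' j' r"
proof -
  have "growth X i j r \<le> growth X i' j r"
    using \<open>i \<le> i'\<close>
    by (induction rule: dec_induct)
      (use growth_interlaces(2)[of X, OF X] in \<open>auto simp: interlaces_def intro: order_trans\<close>)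
  also have "\<dots> \<le> growth X i' j' r"
    using \<open>j \<le> j'\<close>
    by (induction rule: dec_induct)
      (use growth_interlaces(1)[of X, OF X] in \<open>auto simp: interlaces_def intro: order_trans\<close>)
  finally show ?thesis .
qed

lemma growth_support:
  assumes X: "\<And>p q. 0 \<le> X p q" and "i \<le> r"
  shows "growth X i j r = 0"
proof -
  have "growth X i j r \<le> 0"
    using \<open>i \<le> r\<close>
  proof (induction i arbitrary: r)
    case (Suc i)
    then obtain q where q: "r = Suc q" "i \<le> q" by (cases r) auto
    have "growth X (Suc i) j (Suc q) \<le> growth X i j q"
      using growth_interlaces(2)[of X, OF X] by (auto simp: interlaces_def)
    with Suc.IH[OF q(2)] q(1) show ?case by simp
  qed simp
  with growth_mono[of X 0 i j j r, OF X] show ?thesis by simp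
qed

text \<open>As \<open>max\<close> and \<open>min\<close> of two numbers add up to their sum, the
  local rule is inclusion-exclusion for sizes. \<open>K\<close> bounds the number of rows.\<close>

lemma sum_local_rule:
  assumes "\<alpha> K = 0" "\<beta> K = 0" "\<beta>' K = 0" "local_rule x \<alpha> \<beta> \<beta>' K = 0"
  shows "sum (local_rule x \<alpha> \<beta> \<beta>') {..<K} = sum \<beta> {..<K} + sum \<beta>' {..<K} - sum \<alpha> {..<K} + x"
proof -
  \<comment> \<open>The vanishing summand \<open>K\<close> is added so that, once row 0 is split
    off, the \<open>min\<close> terms run over \<open>{..<K}\<close> as the \<open>max\<close> terms
    do.\<close>
  have "sum (local_rule x \<alpha> \<beta> \<beta>') {..<K} = sum (local_rule x \<alpha> \<beta> \<beta>') {..<Suc K}"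
    using assms by simp
  also have "\<dots> = (\<Sum>r<Suc K. max (\<beta> r) (\<beta>' r)) + (\<Sum>r<Suc K. case r of 0 \<Rightarrow> x | Suc q \<Rightarrow> min (\<beta> q) (\<beta>' q) - \<alpha> q)"
    unfolding local_rule_def by (rule sum.distrib)
  also have "(\<Sum>r<Suc K. max (\<beta> r) (\<beta>' r)) = (\<Sum>r<K. max (\<beta> r) (\<beta>' r))"
    using assms by simp
  also have "(\<Sum>r<Suc K. case r of 0 \<Rightarrow> x | Suc q \<Rightarrow> min (\<beta> q) (\<beta>' q) - \<alpha> q) = x + (\<Sum>r<K. min (\<beta> r) (\<beta>' r) - \<alpha> r)"
    by (simp only: sum.lessThan_Suc_shift nat.case)
  also have "(\<Sum>r<K. max (\<beta> r) (\<beta>' r)) + (x + (\<Sum>r<K. min (\<beta> r) (\<beta>' r) - \<alpha> r))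
      = x + (\<Sum>r<K. (max (\<beta> r) (\<beta>' r) + min (\<beta> r) (\<beta>' r)) - \<alpha> r)"
    by (simp add: sum.distrib sum_subtractf)
  also have "(\<lambda>r. (max (\<beta> r) (\<beta>' r) + min (\<beta> r) (\<beta>' r)) - \<alpha> r) = (\<lambda>r. \<beta> r + \<beta>' r - \<alpha> r)"
    by (auto simp: max_def min_def)
  finally show ?thesis by (simp add: sum.distrib sum_subtractf)
qed

lemma growth_size:
  assumes X: "\<And>p q. 0 \<le> X p q" and "i \<le> K"
  shows "sum (growth X i j) {..<K} = (\<Sum>p\<in>{1..i}. \<Sum>q\<in>{1..j}. X p q)"
  using \<open>i \<le> K\<close>
proof (induction i arbitrary: j)
  case (Suc i)
  note Suc_i = Suc
  show ?case
  proof (induction j)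
    case (Suc j)
    have "sum (growth X (Suc i) (Suc j)) {..<K} = sum (growth X i (Suc j)) {..<K}
        + sum (growth X (Suc i) j) {..<K} - sum (growth X i j) {..<K} + X (Suc i) (Suc j)"
      unfolding growth.simps
      by (rule sum_local_rule)
        (use Suc_i(2) growth_support[of X, OF X] in \<open>simp_all flip: growth.simps\<close>)
    then show ?case
      using Suc_i Suc by (simp add: sum.distrib)
  qed simp
qed simp

text \<open>A nonnegative integer sequence with sum 1 has one nonzero entry, equal to 1. The truth
  value \<open>b\<close> treats steps with and without a box together.\<close>

lemma box_step:
  assumes le: "\<And>r. \<alpha> r \<le> \<beta> r" and supp: "\<And>r. K \<le> r \<Longrightarrow> \<alpha> r = \<beta> r"
    and sum: "sum \<beta> {..<K} = sum \<alpha> {..<K} + of_bool b"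
  shows "if b then \<exists>r. \<beta> = add_box r \<alpha> else \<beta> = \<alpha>"
proof -
  have total: "(\<Sum>r<K. \<beta> r - \<alpha> r) = of_bool b"
    using sum by (simp add: sum_subtractf)
  have nonneg: "\<And>r. 0 \<le> \<beta> r - \<alpha> r"
    using le by simp
  show ?thesis
  proof (cases b)
    case True
    then have "(\<Sum>r<K. \<beta> r - \<alpha> r) \<noteq> 0"
      using total by simp
    then obtain r where r: "r < K" "\<beta> r - \<alpha> r \<noteq> 0"
      by (meson lessThan_iff sum.neutral)
    have "(\<Sum>q<K. \<beta> q - \<alpha> q) = (\<beta> r - \<alpha> r) + (\<Sum>q\<in>{..<K} - {r}. \<beta> q - \<alpha> q)"
      using r(1) by (simp add: sum.remove)
    moreover have "0 \<le> (\<Sum>q\<in>{..<K} - {r}. \<beta> q - \<alpha> q)"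
      by (rule sum_nonneg) (use nonneg in auto)
    moreover have "\<beta> r - \<alpha> r \<ge> 1"
      using r(2) nonneg[of r] by simp
    ultimately have eq: "\<beta> r - \<alpha> r = 1" "(\<Sum>q\<in>{..<K} - {r}. \<beta> q - \<alpha> q) = 0"
      using total True by auto
    have "\<beta> q = \<alpha> q" if "q \<noteq> r" for q
    proof (cases "q < K")
      case True
      then show ?thesis
        using eq(2) that sum_nonneg_eq_0_iff[of "{..<K} - {r}" "\<lambda>q. \<beta> q - \<alpha> q"] nonneg by auto
    qed (use supp[of q] in auto)
    then have "\<beta> = add_box r \<alpha>"
      using eq(1) by (auto simp: add_box_def fun_eq_iff)
    then show ?thesis using True by auto
  next
    case False
    then have "\<forall>r\<in>{..<K}. \<beta> r - \<alpha> r = 0"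
      using total nonneg sum_nonneg_eq_0_iff[of "{..<K}" "\<lambda>q. \<beta> q - \<alpha> q"] by auto
    then have "\<beta> r = \<alpha> r" for r
      using supp[of r] by (cases "r < K") auto
    then show ?thesis using False by auto
  qed
qed

lemma add_box_inject [simp]: "add_box r \<alpha> = add_box s \<alpha> \<longleftrightarrow> r = s"
  by (auto simp: add_box_def fun_eq_iff split: if_splits)

lemma local_rule_trivial [simp]:
  "local_rule 0 \<alpha> \<alpha> (add_box t \<alpha>) = add_box t \<alpha>"
  "local_rule 0 \<alpha> (add_box t \<alpha>) \<alpha> = add_box t \<alpha>"
  "local_rule 0 \<alpha> \<alpha> \<alpha> = \<alpha>"
  by (auto simp: local_rule_def add_box_def fun_eq_iff split: nat.split)

lemma local_rule_new [simp]: "local_rule 1 \<alpha> \<alpha> \<alpha> = add_box 0 \<alpha>"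
  by (auto simp: local_rule_def add_box_def fun_eq_iff split: nat.split)

text \<open>This is the bumping rule: boxes in different rows coexist, while of two boxes in the
  same row one is pushed to the next row.\<close>

lemma local_rule_boxes:
  "local_rule 0 \<alpha> (add_box t \<alpha>) (add_box a \<alpha>) = add_box (if t = a then Suc a else t) (add_box a \<alpha>)"
  by (auto simp: local_rule_def add_box_def fun_eq_iff split: nat.split)

lemma add_box_swap:
  "add_box (if t = a then Suc a else t) (add_box a \<alpha>) = add_box (if t = a then Suc a else a) (add_box t \<alpha>)"
  by (auto simp: add_box_def fun_eq_iff)

section \<open>Robinson-Schensted shapes of permutation matrices\<close>

definition perm_matrix :: "(nat \<Rightarrow> nat) \<Rightarrow> nat \<Rightarrow> nat \<Rightarrow> int" where
  "perm_matrix \<pi> p q = of_bool (\<pi> p = q)"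

abbreviation perm_growth :: "(nat \<Rightarrow> nat) \<Rightarrow> nat \<Rightarrow> nat \<Rightarrow> nat \<Rightarrow> int" where
  "perm_growth \<pi> \<equiv> growth (perm_matrix \<pi>)"

lemma perm_matrix_nonneg: "0 \<le> perm_matrix \<pi> p q"
  by (simp add: perm_matrix_def)

lemmas perm_growth_interlaces = growth_interlaces[of "perm_matrix \<pi>" for \<pi>, OF perm_matrix_nonneg]
lemmas perm_growth_mono = growth_mono[of "perm_matrix \<pi>" for \<pi>, OF perm_matrix_nonneg]
lemmas perm_growth_support = growth_support[of "perm_matrix \<pi>" for \<pi>, OF perm_matrix_nonneg]
lemmas perm_growth_size = growth_size[of "perm_matrix \<pi>" for \<pi>, OF perm_matrix_nonneg]

lemma perm_growth_step:
  "if \<pi> (Suc i) \<in> {1..j} then \<exists>r. perm_growth \<pi> (Suc i) j = add_box r (perm_growth \<pi> i j)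
   else perm_growth \<pi> (Suc i) j = perm_growth \<pi> i j"
proof (rule box_step[where K = "Suc i"])
  show "perm_growth \<pi> i j r \<le> perm_growth \<pi> (Suc i) j r" for r
    by (rule perm_growth_mono) auto
  show "perm_growth \<pi> i j r = perm_growth \<pi> (Suc i) j r" if "Suc i \<le> r" for r
    using that by (simp add: perm_growth_support)
  show "sum (perm_growth \<pi> (Suc i) j) {..<Suc i}
      = sum (perm_growth \<pi> i j) {..<Suc i} + of_bool (\<pi> (Suc i) \<in> {1..j})"
    by (simp only: perm_growth_size le_refl le_SucI) (simp add: perm_matrix_def of_bool_def sum.delta)
qed

lemma perm_growth_column_step:
  assumes "inj \<pi>"
  shows "if \<exists>p\<in>{1..i}. \<pi> p = Suc j
    then \<exists>r. perm_growth \<pi> i (Suc j) = add_box r (perm_growth \<pi> i j)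
    else perm_growth \<pi> i (Suc j) = perm_growth \<pi> i j"
proof (rule box_step[where K = i])
  show "perm_growth \<pi> i j r \<le> perm_growth \<pi> i (Suc j) r" for r
    by (rule perm_growth_mono) auto
  show "perm_growth \<pi> i j r = perm_growth \<pi> i (Suc j) r" if "i \<le> r" for r
    using that by (simp add: perm_growth_support)
  have "(\<Sum>p = 1..i. perm_matrix \<pi> p (Suc j)) = of_bool (\<exists>p\<in>{1..i}. \<pi> p = Suc j)"
  proof (cases "\<exists>p\<in>{1..i}. \<pi> p = Suc j")
    case True
    then obtain p where p: "p \<in> {1..i}" "\<pi> p = Suc j" by blast
    then have "\<pi> q = Suc j \<longleftrightarrow> q = p" for q
      using inj_eq[OF assms, of q p] by simp
    then have "(\<Sum>p = 1..i. perm_matrix \<pi> p (Suc j)) = (\<Sum>q = 1..i. if q = p then 1 else 0)"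
      by (simp add: perm_matrix_def of_bool_def)
    also have "\<dots> = 1"
      using p(1) by simp
    finally show ?thesis using True by simp
  qed (simp add: perm_matrix_def)
  then show "sum (perm_growth \<pi> i (Suc j)) {..<i}
      = sum (perm_growth \<pi> i j) {..<i} + of_bool (\<exists>p\<in>{1..i}. \<pi> p = Suc j)"
    by (simp add: perm_growth_size sum.distrib)
qed

text \<open>
  By induction on \<open>j\<close>: bumping by a new row of the matrix does not change how the rows of two
  consecutive boxes compare.
\<close>

lemma perm_growth_descent:
  assumes "inj \<pi>" "\<pi> 0 = 0"
    and "\<pi> (Suc i) \<le> j" "\<pi> (Suc (Suc i)) \<le> j"
    and "perm_growth \<pi> (Suc i) j = add_box r (perm_growth \<pi> i j)"
    and "perm_growth \<pi> (Suc (Suc i)) j = add_box s (perm_growth \<pi> (Suc i) j)"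
  shows "r < s \<longleftrightarrow> \<pi> (Suc (Suc i)) < \<pi> (Suc i)"
  using assms(3-)
proof (induction j arbitrary: r s)
  case 0
  then show ?case using inj_eq[OF assms(1), of "Suc i" 0] assms(2) by simp
next
  case (Suc j)
  let ?G = "perm_growth \<pi>"
  note inj = inj_eq[OF assms(1)]
  have pos: "1 \<le> \<pi> p" if "1 \<le> p" for p
    using inj[of p 0] assms(2) that by (cases "\<pi> p") auto
  have ne: "\<pi> (Suc i) \<noteq> \<pi> (Suc (Suc i))"
    by (simp add: inj)
  have step: "?G (Suc p) (Suc j)
      = local_rule (of_bool (\<pi> (Suc p) = Suc j)) (?G p j) (?G p (Suc j)) (?G (Suc p) j)" for p
    by (simp add: perm_matrix_def)
  note [simp del] = growth.simps(3)
  consider (old) "\<pi> (Suc i) \<le> j" "\<pi> (Suc (Suc i)) \<le> j"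
    | (fst) "\<pi> (Suc i) = Suc j" "\<pi> (Suc (Suc i)) \<le> j"
    | (snd) "\<pi> (Suc i) \<le> j" "\<pi> (Suc (Suc i)) = Suc j"
    using Suc.prems(1,2) ne by linarith
  then show ?case
  proof cases
    case old
    obtain a where a: "?G (Suc i) j = add_box a (?G i j)"
      using perm_growth_step[of \<pi> i j] pos[of "Suc i"] old by auto
    obtain b where b: "?G (Suc (Suc i)) j = add_box b (?G (Suc i) j)"
      using perm_growth_step[of \<pi> "Suc i" j] pos[of "Suc (Suc i)"] old by auto
    have IH: "a < b \<longleftrightarrow> \<pi> (Suc (Suc i)) < \<pi> (Suc i)"
      using Suc.IH[OF old a b] .
    have X: "\<pi> (Suc i) \<noteq> Suc j" "\<pi> (Suc (Suc i)) \<noteq> Suc j"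
      using old by auto
    have "?G i (Suc j) = ?G i j \<or> (\<exists>t. ?G i (Suc j) = add_box t (?G i j))"
      using perm_growth_column_step[OF assms(1), of i j] by presburger
    then have "r < s \<longleftrightarrow> a < b"
    proof (elim disjE exE)
      assume 0: "?G i (Suc j) = ?G i j"
      have 1: "?G (Suc i) (Suc j) = ?G (Suc i) j"
        using X by (simp add: step[of i] 0 a)
      have 2: "?G (Suc (Suc i)) (Suc j) = ?G (Suc (Suc i)) j"
        using X by (simp add: step[of "Suc i"] 1 b)
      show ?thesis using Suc.prems(3,4) unfolding 0 1 2 a b by simp
    next
      fix t assume 0: "?G i (Suc j) = add_box t (?G i j)"
      \<comment> \<open>\<open>u\<close> is the row of the box that column \<open>Suc j\<close> has
        added by line \<open>Suc i\<close>, after a possible collision with \<open>a\<close>; this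
        box meets \<open>b\<close> in the next line.\<close>
      define u where "u = (if t = a then Suc a else t)"
      have 1: "?G (Suc i) (Suc j) = add_box u (?G (Suc i) j)"
        using X by (simp add: step[of i] 0 a local_rule_boxes u_def)
      have 2: "?G (Suc (Suc i)) (Suc j) = add_box (if u = b then Suc b else u) (add_box b (?G (Suc i) j))"
        using X by (simp add: step[of "Suc i"] 1 b local_rule_boxes)
      have "r = (if t = a then Suc a else a)"
        using Suc.prems(3) unfolding 1 a 0 u_def add_box_swap add_box_inject by simp
      moreover have "s = (if u = b then Suc b else b)"
        using Suc.prems(4) unfolding 2 1 add_box_swap add_box_inject by simp
      ultimately show ?thesis by (auto simp: u_def)
    qed
    then show ?thesis using IH by simp
  next
    \<comment> \<open>The larger entry comes first and enters in row 0, so a following box in row 0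
      is bumped and \<open>s\<close> is positive. In the case \<open>snd\<close> the larger entry
      comes second, so \<open>s\<close> is 0.\<close>
    case fst
    have "\<not> (\<exists>p\<in>{1..i}. \<pi> p = Suc j)"
      using inj fst(1) by (metis Suc_n_not_le_n atLeastAtMost_iff)
    then have 0: "?G i (Suc j) = ?G i j"
      using perm_growth_column_step[OF assms(1), of i j] by simp
    have a: "?G (Suc i) j = ?G i j"
      using perm_growth_step[of \<pi> i j] fst by simp
    obtain b where b: "?G (Suc (Suc i)) j = add_box b (?G (Suc i) j)"
      using perm_growth_step[of \<pi> "Suc i" j] pos[of "Suc (Suc i)"] fst by auto
    have 1: "?G (Suc i) (Suc j) = add_box 0 (?G i j)"
      using fst by (simp add: step[of i] 0 a)
    have 2: "?G (Suc (Suc i)) (Suc j) = add_box (if 0 = b then Suc b else b) (add_box 0 (?G i j))"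
      unfolding add_box_swap[symmetric] using fst by (simp add: step[of "Suc i"] 1 b a local_rule_boxes)
    have "r = 0" "s = (if 0 = b then Suc b else b)"
      using Suc.prems(3,4) unfolding 2 1 0 add_box_inject by simp_all
    then show ?thesis using fst by auto
  next
    case snd
    have "\<not> (\<exists>p\<in>{1..Suc i}. \<pi> p = Suc j)"
      using inj snd(2) by (metis Suc_n_not_le_n atLeastAtMost_iff)
    then have 1: "?G (Suc i) (Suc j) = ?G (Suc i) j"
      using perm_growth_column_step[OF assms(1), of "Suc i" j] by (simp only: if_False)
    have b: "?G (Suc (Suc i)) j = ?G (Suc i) j"
      using perm_growth_step[of \<pi> "Suc i" j] snd by simp
    have "?G (Suc (Suc i)) (Suc j) = add_box 0 (?G (Suc i) j)"
      using snd by (simp add: step[of "Suc i"] 1 b)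
    then have "s = 0"
      using Suc.prems(4) by (simp add: 1)
    then show ?thesis using snd by simp
  qed
qed

text \<open>Schensted's theorem for each corner submatrix. Without an entry at its corner the first
  row is the larger of the two neighbouring ones; an entry adds one to it, just as it extends an
  increasing subsequence.\<close>

lemma schensted_first_row:
  assumes "inj \<pi>" "\<pi> 0 = 0"
  shows "int k \<le> perm_growth \<pi> i j 0 \<longleftrightarrow>
    (\<exists>S\<subseteq>{1..i}. card S = k \<and> strict_mono_on S \<pi> \<and> \<pi> ` S \<subseteq> {..j})"
proof
  assume "int k \<le> perm_growth \<pi> i j 0"
  then show "\<exists>S\<subseteq>{1..i}. card S = k \<and> strict_mono_on S \<pi> \<and> \<pi> ` S \<subseteq> {..j}"
  proof (induction i arbitrary: j k)
    case 0
    then show ?case by (auto intro!: exI[of _ "{}"] simp: strict_mono_on_def)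
  next
    case (Suc i)
    note IH = Suc.IH
    show ?case
      using Suc.prems
    proof (induction j arbitrary: k)
      case 0
      then show ?case by (auto intro!: exI[of _ "{}"] simp: strict_mono_on_def)
    next
      case (Suc j)
      show ?case
      proof (cases "k = 0 \<or> \<pi> (Suc i) \<noteq> Suc j")
        case True
        then consider "k = 0" | "int k \<le> perm_growth \<pi> i (Suc j) 0" | "int k \<le> perm_growth \<pi> (Suc i) j 0"
        proof (cases "k = 0")
          case False
          then have "perm_matrix \<pi> (Suc i) (Suc j) = 0"
            using True by (simp add: perm_matrix_def)
          then have "int k \<le> max (perm_growth \<pi> i (Suc j) 0) (perm_growth \<pi> (Suc i) j 0)"
            using Suc.prems by (simp add: local_rule_def)
          then show ?thesis using that(2,3) by (auto simp: le_max_iff_disj)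
        qed (use that(1) in blast)
        then show ?thesis
        proof cases
          case 1
          then show ?thesis by (auto intro!: exI[of _ "{}"] simp: strict_mono_on_def)
        next
          case 2
          then obtain S where "S \<subseteq> {1..i}" "card S = k" "strict_mono_on S \<pi>" "\<pi> ` S \<subseteq> {..Suc j}"
            using IH by blast
          then show ?thesis by (intro exI[of _ S]) auto
        next
          case 3
          then obtain S where "S \<subseteq> {1..Suc i}" "card S = k" "strict_mono_on S \<pi>" "\<pi> ` S \<subseteq> {..j}"
            using Suc.IH by blast
          then show ?thesis by (intro exI[of _ S]) auto
        qed
      next
        case False
        then obtain l where l: "k = Suc l" and pi: "\<pi> (Suc i) = Suc j"
          by (cases k) auto
        have "\<not> (\<exists>p\<in>{1..i}. \<pi> p = Suc j)"
          using inj_eq[OF assms(1)] pi by (metis Suc_n_not_le_n atLeastAtMost_iff)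
        then have "perm_growth \<pi> i (Suc j) = perm_growth \<pi> i j"
          using perm_growth_column_step[OF assms(1), of i j] by (simp only: if_False)
        moreover have "perm_growth \<pi> (Suc i) j = perm_growth \<pi> i j"
          using perm_growth_step[of \<pi> i j] pi by simp
        moreover have "perm_matrix \<pi> (Suc i) (Suc j) = 1"
          by (simp add: perm_matrix_def pi)
        ultimately have "int l \<le> perm_growth \<pi> i j 0"
          using Suc.prems l by (simp add: add_box_def)
        then obtain S where S: "S \<subseteq> {1..i}" "card S = l" "strict_mono_on S \<pi>" "\<pi> ` S \<subseteq> {..j}"
          using IH by blast
        have "card (insert (Suc i) S) = k"
          using S(1,2) l by (subst card_insert_disjoint) (auto intro: finite_subset)
        moreover have "strict_mono_on (insert (Suc i) S) \<pi>"
          using S pi by (fastforce simp: strict_mono_on_def)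
        ultimately show ?thesis
          using S(1,4) pi by (intro exI[of _ "insert (Suc i) S"]) auto
      qed
    qed
  qed
next
  assume "\<exists>S\<subseteq>{1..i}. card S = k \<and> strict_mono_on S \<pi> \<and> \<pi> ` S \<subseteq> {..j}"
  then obtain S where "S \<subseteq> {1..i}" "card S = k" "strict_mono_on S \<pi>" "\<pi> ` S \<subseteq> {..j}"
    by blast
  then show "int k \<le> perm_growth \<pi> i j 0"
  proof (induction i arbitrary: j k S)
    case 0
    then show ?case by simp
  next
    case (Suc i)
    show ?case
    proof (cases "Suc i \<in> S")
      case False
      then have "S \<subseteq> {1..i}"
        using Suc.prems(1) by (auto simp: atLeastAtMostSuc_conv)
      then have "int k \<le> perm_growth \<pi> i j 0"
        using Suc by blast
      also have "\<dots> \<le> perm_growth \<pi> (Suc i) j 0"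
        by (rule perm_growth_mono) auto
      finally show ?thesis .
    next
      case True
      have "\<pi> (Suc i) \<noteq> 0"
        using inj_eq[OF assms(1), of "Suc i" 0] assms(2) by simp
      \<comment> \<open>\<open>Suc i\<close> is the last element of \<open>S\<close>, so all other
        values on \<open>S\<close> are below \<open>Suc q\<close> and the induction hypothesis
        applies at column \<open>q\<close>.\<close>
      then obtain q where q: "\<pi> (Suc i) = Suc q"
        by (cases "\<pi> (Suc i)") auto
      have S: "S - {Suc i} \<subseteq> {1..i}"
        using Suc.prems(1) by auto
      have "finite S"
        using Suc.prems(1) finite_subset by blast
      then have k: "k = Suc (card (S - {Suc i}))"
        using True Suc.prems(2) card_Suc_Diff1 by fastforce
      have "strict_mono_on (S - {Suc i}) \<pi>"
        using Suc.prems(3) by (auto simp: strict_mono_on_def)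
      moreover have "\<pi> ` (S - {Suc i}) \<subseteq> {..q}"
        using Suc.prems(3) S True q unfolding strict_mono_on_def
        by (smt (verit) DiffE atLeastAtMost_iff atMost_iff image_subsetI le_imp_less_Suc less_Suc_eq_le subsetD)
      ultimately have "int (card (S - {Suc i})) \<le> perm_growth \<pi> i q 0"
        using Suc.IH[OF S refl] by blast
      also have "\<dots> \<le> perm_growth \<pi> i (Suc q) 0"
        by (rule perm_growth_mono) auto
      also have "\<dots> + 1 \<le> perm_growth \<pi> (Suc i) (Suc q) 0"
        by (simp add: local_rule_def perm_matrix_def q)
      also have "\<dots> \<le> perm_growth \<pi> (Suc i) j 0"
        by (rule perm_growth_mono) (use Suc.prems(4) True q in auto)
      finally show ?thesis using k by simp
    qed
  qed
qed

section \<open>Symmetry and inversion of growth diagrams\<close>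

lemma growth_transpose: "growth (\<lambda>p q. X q p) i j = growth X j i"
proof (induction i arbitrary: j)
  case (Suc i)
  note Suc_i = Suc
  show ?case
  proof (induction j)
    case (Suc j)
    then show ?case
      using Suc_i[of j] Suc_i[of "Suc j"] by (auto simp: local_rule_def fun_eq_iff max.commute min.commute split: nat.split)
  qed simp
qed simp

lemma growth_cong:
  assumes "\<And>p q. p \<in> {1..i} \<Longrightarrow> q \<in> {1..j} \<Longrightarrow> X p q = Y p q"
  shows "growth X i j = growth Y i j"
  using assms
proof (induction i arbitrary: j)
  case (Suc i)
  note Suc_i = Suc
  show ?case
    using Suc.prems
  proof (induction j)
    case (Suc j)
    have "growth X i j = growth Y i j" "growth X i (Suc j) = growth Y i (Suc j)"
      by (rule Suc_i; use Suc.prems in auto)+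
    moreover have "growth X (Suc i) j = growth Y (Suc i) j"
      by (rule Suc.IH) (use Suc.prems in auto)
    ultimately show ?case
      using Suc.prems by simp
  qed simp
qed simp

text \<open>The local rule is solved for the inner shape and the entry, going backwards from the
  outer boundary. For a permutation, the two boundary chains are its recording and insertion
  tableaux.\<close>

lemma growth_determined:
  assumes "\<And>i. i \<le> N \<Longrightarrow> growth X i N = growth Y i N" "\<And>j. j \<le> N \<Longrightarrow> growth X N j = growth Y N j"
    and "p \<in> {1..N}" "q \<in> {1..N}"
  shows "X p q = Y p q"
proof -
  have eq: "growth X (N - a) (N - b) = growth Y (N - a) (N - b)" for a b
  proof (induction a arbitrary: b)
    case 0
    show ?case by (simp add: assms(2))
  next
    case (Suc a)
    note Suc_a = Suc
    show ?case
    proof (induction b)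
      case 0
      show ?case by (simp add: assms(1))
    next
      case (Suc b)
      show ?case
      proof (cases "Suc a \<le> N \<and> Suc b \<le> N")
        case False
        \<comment> \<open>Subtraction truncates: an index that overshoots means a shape on an axis,
          which is empty.\<close>
        then have "N - Suc a = 0 \<or> N - Suc b = 0" by auto
        then show ?thesis by (elim disjE) simp_all
      next
        case True
        define i j where "i = N - Suc a" and "j = N - Suc b"
        have ij: "N - a = Suc i" "N - b = Suc j"
          using True by (auto simp: i_def j_def)
        have *: "growth Z i j r = min (growth Z i (Suc j) r) (growth Z (Suc i) j r)
            + max (growth Z i (Suc j) (Suc r)) (growth Z (Suc i) j (Suc r)) - growth Z (Suc i) (Suc j) (Suc r)"
          for Z r
          by (rule local_rule_inverse(1)[OF growth.simps(3)])
        have "growth X i j = growth Y i j"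
          using Suc Suc_a[of b] Suc_a[of "Suc b"]
          by (simp only: fun_eq_iff *[of X] *[of Y] flip: ij i_def j_def) simp
        then show ?thesis by (simp add: i_def j_def)
      qed
    qed
  qed
  have eq': "growth X i j = growth Y i j" if "i \<le> N" "j \<le> N" for i j
    using eq[of "N - i" "N - j"] that by simp
  obtain i j where ij: "p = Suc i" "q = Suc j"
    using assms(3,4) by (cases p; cases q) auto
  have "Z (Suc i) (Suc j) = growth Z (Suc i) (Suc j) 0 - max (growth Z i (Suc j) 0) (growth Z (Suc i) j 0)" for Z
    by (rule local_rule_inverse(2)[OF growth.simps(3)])
  note inverse = this
  have "growth X (Suc i) (Suc j) = growth Y (Suc i) (Suc j)"
    "growth X i (Suc j) = growth Y i (Suc j)" "growth X (Suc i) j = growth Y (Suc i) j"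
    using assms(3,4) ij by (auto intro!: eq' simp del: growth.simps)
  then show ?thesis
    unfolding ij inverse[of X] inverse[of Y] by (simp only:)
qed

text \<open>
  The local rule run backwards: \<open>shrink d a b\<close> is the shape at \<open>(N - a, N - b)\<close> when the shapes at
  \<open>(N - a, N)\<close> and \<open>(N, N - a)\<close> are both \<open>d a\<close>. Equal boundary values make the matrix symmetric, which
  is how chains of partitions yield involutions.
\<close>

fun shrink :: "(nat \<Rightarrow> nat \<Rightarrow> int) \<Rightarrow> nat \<Rightarrow> nat \<Rightarrow> nat \<Rightarrow> int" where
  "shrink d 0 b = d b"
| "shrink d (Suc a) 0 = d (Suc a)"
| "shrink d (Suc a) (Suc b) = (\<lambda>r. min (shrink d a (Suc b) r) (shrink d (Suc a) b r)
    + max (shrink d a (Suc b) (Suc r)) (shrink d (Suc a) b (Suc r)) - shrink d a b (Suc r))"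

lemma shrink_0 [simp]: "shrink d a 0 = d a"
  by (cases a) auto

lemma shrink_commute: "shrink d a b = shrink d b a"
proof (induction a arbitrary: b)
  case (Suc a)
  note Suc_a = Suc
  show ?case
  proof (induction b)
    case (Suc b)
    then show ?case
      using Suc_a[of b] Suc_a[of "Suc b"] by (auto simp: fun_eq_iff max.commute min.commute)
  qed simp
qed simp

lemma shrink_interlaces:
  assumes d: "\<And>a. interlaces (d (Suc a)) (d a)"
  shows "interlaces (shrink d (Suc a) b) (shrink d a b)"
proof -
  have step: "interlaces (\<lambda>r. min (\<beta> r) (\<beta>' r) + max (\<beta> (Suc r)) (\<beta>' (Suc r)) - \<gamma> (Suc r)) \<beta>"
      "interlaces (\<lambda>r. min (\<beta> r) (\<beta>' r) + max (\<beta> (Suc r)) (\<beta>' (Suc r)) - \<gamma> (Suc r)) \<beta>'"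
    if "interlaces \<beta> \<gamma>" "interlaces \<beta>' \<gamma>" for \<beta> \<beta>' \<gamma>
  proof -
    have "\<beta> r \<le> \<gamma> r" "\<beta>' r \<le> \<gamma> r" "\<gamma> (Suc r) \<le> \<beta> r" "\<gamma> (Suc r) \<le> \<beta>' r" for r
      using that by (auto simp: interlaces_def)
    then show "interlaces (\<lambda>r. min (\<beta> r) (\<beta>' r) + max (\<beta> (Suc r)) (\<beta>' (Suc r)) - \<gamma> (Suc r)) \<beta>"
      "interlaces (\<lambda>r. min (\<beta> r) (\<beta>' r) + max (\<beta> (Suc r)) (\<beta>' (Suc r)) - \<gamma> (Suc r)) \<beta>'"
      unfolding interlaces_def by (smt (verit))+
  qed
  have row: "interlaces (shrink d (Suc a) b) (shrink d a b)"
    if B: "\<And>b. interlaces (shrink d a (Suc b)) (shrink d a b)" for a b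
  proof (induction b)
    case 0
    show ?case by (simp add: d)
  next
    case (Suc b)
    show ?case using step(1)[OF B Suc] by simp
  qed
  have "interlaces (shrink d a (Suc b)) (shrink d a b)" for b
  proof (induction a arbitrary: b)
    case 0
    show ?case by (simp add: d)
  next
    case (Suc a)
    show ?case using step(2)[OF Suc row[OF Suc]] by simp
  qed
  then show ?thesis by (rule row)
qed

lemma shrink_nonneg:
  assumes "\<And>a. interlaces (d (Suc a)) (d a)" "\<And>a r. 0 \<le> d a r"
  shows "0 \<le> shrink d a b r"
proof (induction a arbitrary: r)
  case 0
  show ?case by (simp add: assms(2))
next
  case (Suc a)
  have "shrink d a b (Suc r) \<le> shrink d (Suc a) b r"
    using shrink_interlaces[of d, OF assms(1)] by (auto simp: interlaces_def)
  with Suc[of "Suc r"] show ?case by simp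
qed

text \<open>Shapes only lose boxes going inwards, so an empty shape on the boundary empties its
  whole line. This provides the zero axes from which \<open>growth\<close> starts.\<close>

lemma shrink_zero:
  assumes "\<And>a. interlaces (d (Suc a)) (d a)" "\<And>a r. 0 \<le> d a r" "d a = (\<lambda>r. 0)"
  shows "shrink d a b = (\<lambda>r. 0)"
proof -
  have "shrink d a b r \<le> 0" for r
  proof (induction b)
    case 0
    show ?case by (simp add: assms(3))
  next
    case (Suc b)
    have "shrink d (Suc b) a r \<le> shrink d b a r"
      using shrink_interlaces[of d, OF assms(1)] by (auto simp: interlaces_def)
    with Suc show ?case by (simp add: shrink_commute[of d _ a])
  qed
  then show ?thesis
    using shrink_nonneg[of d, OF assms(1,2)] by (auto simp: fun_eq_iff intro: antisym)
qed

lemma growth_shrink: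
  assumes d: "\<And>a. interlaces (d (Suc a)) (d a)" "\<And>a r. 0 \<le> d a r" and "d N = (\<lambda>r. 0)"
  obtains X where "\<And>p q. 0 \<le> X p q" "\<And>p q. X p q = X q p"
    "\<And>i. i \<le> N \<Longrightarrow> growth X i N = d (N - i)"
proof -
  define H where "H i j = shrink d (N - i) (N - j)" for i j
  \<comment> \<open>The entry is the one that row 0 of the local rule demands. It is nonnegative
    because shapes grow, and symmetric because \<open>shrink\<close> is.\<close>
  define X where "X p q = (if p \<in> {1..N} \<and> q \<in> {1..N}
    then H p q 0 - max (H (p - 1) q 0) (H p (q - 1) 0) else 0)" for p q
  have H_commute: "H i j = H j i" for i j
    unfolding H_def by (rule shrink_commute)
  have H_le: "H i j r \<le> H (Suc i) j r" for i j r
  proof (cases "Suc i \<le> N")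
    case True
    then have "N - i = Suc (N - Suc i)" by simp
    then show ?thesis
      using shrink_interlaces[of d, OF d(1)] by (simp add: H_def interlaces_def)
  qed (simp add: H_def)
  have H_zero: "H 0 j = (\<lambda>r. 0)" for j
    unfolding H_def using shrink_zero[of d, OF d(1,2)] assms(3) by simp
  have H_growth: "growth X i j = H i j" if "i \<le> N" "j \<le> N" for i j
    using that
  proof (induction i arbitrary: j)
    case 0
    then show ?case by (simp add: H_zero)
  next
    case (Suc i)
    note Suc_i = Suc
    show ?case
      using \<open>j \<le> N\<close>
    proof (induction j)
      case 0
      then show ?case by (simp add: H_commute[of _ 0] H_zero)
    next
      case (Suc j)
      have diff: "N - i = Suc (N - Suc i)" "N - j = Suc (N - Suc j)"
        using Suc_i(2) Suc.prems by auto
      have "H i j r = min (H i (Suc j) r) (H (Suc i) j r)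
          + max (H i (Suc j) (Suc r)) (H (Suc i) j (Suc r)) - H (Suc i) (Suc j) (Suc r)" for r
        unfolding H_def diff by (simp add: min.commute max.commute)
      then show ?case
        using Suc Suc_i by (auto simp: local_rule_def fun_eq_iff X_def split: nat.split)
    qed
  qed
  show ?thesis
  proof (rule that)
    show "0 \<le> X p q" for p q
      using H_le[of "p - 1" q 0] H_le[of "q - 1" p 0] by (auto simp: X_def H_commute[of p])
    show "X p q = X q p" for p q
      using H_commute by (simp add: X_def max.commute)
    show "growth X i N = d (N - i)" if "i \<le> N" for i
      using H_growth[OF that, of N] by (simp add: H_def)
  qed
qed

text \<open>The chain is a standard Young tableau, placed on both outer boundaries. The resulting
  matrix is symmetric and nonnegative, with line sums 1 since each step adds one box, so it belongs
  to an involution.\<close>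

lemma involution_of_chain:
  assumes "c 0 = (\<lambda>r. 0)" and box: "\<And>i. i < N \<Longrightarrow> \<exists>r. c (Suc i) = add_box r (c i)"
    and part: "\<And>i r. i \<le> N \<Longrightarrow> c i (Suc r) \<le> c i r"
  obtains \<pi> where "\<pi> permutes {1..N}" "\<And>p. \<pi> (\<pi> p) = p" "\<And>i. i \<le> N \<Longrightarrow> perm_growth \<pi> i N = c i"
proof -
  have nonneg: "0 \<le> c i r" if "i \<le> N" for i r
    using that
  proof (induction i)
    case 0
    then show ?case using assms(1) by simp
  next
    case (Suc i)
    then show ?case using box[of i] by (auto simp: add_box_def)
  qed
  have inter: "interlaces (c i) (c (Suc i))" if i: "i < N" for i
  proof -
    obtain s where s: "c (Suc i) = add_box s (c i)"
      using box[OF i] by blast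
    have "c (Suc i) (Suc r) \<le> c i r" for r
      using part[of i r] part[of "Suc i" r] i unfolding s by (auto simp: add_box_def split: if_splits)
    then show ?thesis unfolding interlaces_def s by (auto simp: add_box_def)
  qed
  obtain X where X: "\<And>p q. 0 \<le> X p q" "\<And>p q. X p q = X q p"
    "\<And>i. i \<le> N \<Longrightarrow> growth X i N = c (N - (N - i))"
  proof (rule growth_shrink[of "\<lambda>a. c (N - a)" N])
    show "interlaces (c (N - Suc a)) (c (N - a))" for a
    proof (cases "Suc a \<le> N")
      case True
      then have "N - a = Suc (N - Suc a)" by simp
      then show ?thesis using inter[of "N - Suc a"] True by simp
    qed (simp add: assms(1) interlaces_0)
  qed (use nonneg assms(1) in auto)
  have growth_X: "growth X i N = c i" if "i \<le> N" for i
    using X(3)[OF that] that by simp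
  have row: "(\<Sum>q = 1..N. X p q) = 1" if p: "p \<in> {1..N}" for p
  proof -
    obtain i where i: "p = Suc i" using p by (cases p) auto
    obtain s where s: "c (Suc i) = add_box s (c i)"
      using box[of i] i p by auto
    have "s < N"
    proof (rule ccontr)
      assume "\<not> s < N"
      then have "c i s = 0" "c (Suc i) s = 0"
        using growth_support[of X i s N, OF X(1)] growth_support[of X "Suc i" s N, OF X(1)]
          growth_X[of i] growth_X[of "Suc i"] p i by auto
      then show False unfolding s by (simp add: add_box_def)
    qed
    then have "sum (c (Suc i)) {..<N} = sum (c i) {..<N} + 1"
      unfolding s add_box_def by (subst (1 2) sum.remove[of _ s]) auto
    then show ?thesis
      using growth_size[of X i N N, OF X(1)] growth_size[of X "Suc i" N N, OF X(1)] p i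
      by (simp add: growth_X)
  qed
  have unique: "\<exists>!q. q \<in> {1..N} \<and> X p q \<noteq> 0" and one: "q \<in> {1..N} \<Longrightarrow> X p q \<noteq> 0 \<Longrightarrow> X p q = 1"
    if p: "p \<in> {1..N}" for p q
  proof -
    have "\<exists>q\<in>{1..N}. X p q \<noteq> 0"
      using row[OF p] sum.neutral[of "{1..N}" "X p"] by (metis zero_neq_one)
    moreover have rest: "X p q = 1 \<and> (\<forall>q'\<in>{1..N} - {q}. X p q' = 0)" if q: "q \<in> {1..N}" "X p q \<noteq> 0" for q
    proof -
      have "1 = X p q + (\<Sum>q'\<in>{1..N} - {q}. X p q')"
        using row[OF p] q(1) by (simp add: sum.remove)
      moreover have "0 \<le> (\<Sum>q'\<in>{1..N} - {q}. X p q')"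
        by (rule sum_nonneg) (use X(1) in auto)
      moreover have "1 \<le> X p q" using q(2) X(1)[of p q] by simp
      ultimately have "X p q = 1" "(\<Sum>q'\<in>{1..N} - {q}. X p q') = 0" by auto
      then show ?thesis
        using sum_nonneg_eq_0_iff[of "{1..N} - {q}" "X p"] X(1) by auto
    qed
    ultimately show "\<exists>!q. q \<in> {1..N} \<and> X p q \<noteq> 0" by blast
    show "q \<in> {1..N} \<Longrightarrow> X p q \<noteq> 0 \<Longrightarrow> X p q = 1"
      using rest by blast
  qed
  define \<pi> where "\<pi> p = (if p \<in> {1..N} then THE q. q \<in> {1..N} \<and> X p q \<noteq> 0 else p)" for p
  have \<pi>: "\<pi> p \<in> {1..N} \<and> X p (\<pi> p) \<noteq> 0" if "p \<in> {1..N}" for p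
    using theI'[OF unique[OF that]] that by (simp add: \<pi>_def)
  have \<pi>_eq: "X p q \<noteq> 0 \<longleftrightarrow> \<pi> p = q" if "p \<in> {1..N}" "q \<in> {1..N}" for p q
    using unique[OF that(1)] \<pi>[OF that(1)] that(2) by blast
  \<comment> \<open>Symmetry of \<open>X\<close> puts an entry at \<open>(\<pi> p, p)\<close> too,
    so \<open>\<pi>\<close> sends \<open>\<pi> p\<close> back to \<open>p\<close>; bijectivity
    follows.\<close>
  have inv: "\<pi> (\<pi> p) = p" for p
  proof (cases "p \<in> {1..N}")
    case True
    then show ?thesis
      using \<pi>[OF True] \<pi>_eq[of "\<pi> p" p] X(2)[of p "\<pi> p"] by simp
  qed (auto simp: \<pi>_def)
  show ?thesis
  proof (rule that)
    show "\<pi> permutes {1..N}"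
      unfolding permutes_def
    proof (intro conjI allI impI)
      show "\<exists>!p. \<pi> p = q" for q
        using inv by metis
    qed (auto simp: \<pi>_def)
    show "\<pi> (\<pi> p) = p" for p by (rule inv)
    show "perm_growth \<pi> i N = c i" if "i \<le> N" for i
    proof -
      have "perm_growth \<pi> i N = growth X i N"
      proof (rule growth_cong)
        fix p q assume "p \<in> {1..i}" "q \<in> {1..N}"
        then have pq: "p \<in> {1..N}" "q \<in> {1..N}" using that by auto
        show "perm_matrix \<pi> p q = X p q"
          using \<pi>_eq[OF pq] one[OF pq] by (cases "X p q = 0") (auto simp: perm_matrix_def)
      qed
      then show ?thesis using growth_X[OF that] by simp
    qed
  qed
qed

subsection \<open>Ballot words\<close>

definition ballot :: "motzkin_step list \<Rightarrow> bool" where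
  "ballot w \<longleftrightarrow> (\<forall>k\<le>length w. count_list (take k w) Flat \<le> count_list (take k w) Up \<and>
     count_list (take k w) Down \<le> count_list (take k w) Flat)"

text \<open>The letters stand for the three columns, so their numbers are the column heights.\<close>

definition shape :: "motzkin_step list \<Rightarrow> nat \<Rightarrow> int" where
  "shape w r = of_bool (r < count_list w Up) + of_bool (r < count_list w Flat)
     + of_bool (r < count_list w Down)"

lemma ballot_take: "ballot w \<Longrightarrow> ballot (take k w)"
  by (auto simp: ballot_def min_def)

lemma ballot_counts:
  "ballot w \<Longrightarrow> count_list w Flat \<le> count_list w Up \<and> count_list w Down \<le> count_list w Flat"
  unfolding ballot_def by (metis order_refl take_all)

lemma ballot_snoc:
  "ballot (w @ [a]) \<longleftrightarrow> ballot w \<and> count_list (w @ [a]) Flat \<le> count_list (w @ [a]) Up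
     \<and> count_list (w @ [a]) Down \<le> count_list (w @ [a]) Flat" (is "?L \<longleftrightarrow> ?R")
proof
  assume ?L
  then show ?R
    using ballot_take[of "w @ [a]" "length w"] ballot_counts[of "w @ [a]"] by simp
next
  assume R: ?R
  show ?L
    unfolding ballot_def
  proof (intro allI impI)
    fix k assume "k \<le> length (w @ [a])"
    then consider "k \<le> length w" | "k = length (w @ [a])" by fastforce
    then show "count_list (take k (w @ [a])) Flat \<le> count_list (take k (w @ [a])) Up \<and>
        count_list (take k (w @ [a])) Down \<le> count_list (take k (w @ [a])) Flat"
      using R by cases (simp_all add: ballot_def)
  qed
qed

lemma shape_Nil [simp]: "shape [] = (\<lambda>r. 0)"
  by (simp add: shape_def fun_eq_iff)

lemma shape_snoc: "shape (w @ [a]) = add_box (count_list w a) (shape w)"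
  by (cases a) (auto simp: shape_def add_box_def fun_eq_iff)

lemma shape_antimono: "shape w (Suc r) \<le> shape w r"
  by (auto simp: shape_def)

lemma shape_le_3: "shape w r \<le> 3"
  by (auto simp: shape_def)

lemma shape_ballot:
  assumes "ballot w"
  shows "shape w r = (if r < count_list w Down then 3 else if r < count_list w Flat then 2
    else if r < count_list w Up then 1 else 0)"
  using ballot_counts[OF assms] by (auto simp: shape_def)

text \<open>By the ballot condition the box added by \<open>a\<close> extends a row that reaches
  just up to column \<open>a\<close>. Hence the letter can be read off the row of the new
  box.\<close>

lemma shape_at_count:
  assumes "ballot (w @ [a])"
  shows "shape w (count_list w a) = int (level a)"
  using assms ballot_counts[OF assms] ballot_counts[of w]
  by (cases a) (auto simp: ballot_snoc shape_ballot)

lemma shape_inject: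
  assumes "ballot w" "ballot w'" "length w = length w'"
    and "\<And>k. k \<le> length w \<Longrightarrow> shape (take k w) = shape (take k w')"
  shows "w = w'"
  using assms
proof (induction w arbitrary: w' rule: rev_induct)
  case Nil
  then show ?case by simp
next
  case (snoc a w)
  obtain v b where w': "w' = v @ [b]" "length v = length w"
    using snoc.prems(3) by (cases w' rule: rev_cases) auto
  have "w = v"
  proof (rule snoc.IH)
    show "shape (take k w) = shape (take k v)" if "k \<le> length w" for k
      using snoc.prems(4)[of k] that by (simp add: w')
  qed (use snoc.prems(1,2) w' in \<open>auto simp: ballot_snoc\<close>)
  moreover have "shape (w @ [a]) = shape (v @ [b])"
    using snoc.prems(4)[of "Suc (length w)"] w' by simp
  ultimately have "count_list w a = count_list w b"
    by (simp add: shape_snoc)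
  then have "level a = level b"
    using shape_at_count[OF snoc.prems(1)] shape_at_count[of v b] snoc.prems(2) w' \<open>w = v\<close> by simp
  then have "a = b"
    by (cases a; cases b) simp_all
  with w'(1) \<open>w = v\<close> show ?case by simp
qed

text \<open>The letter of a step is the column of its new box, that is, the old length of its row;
  the bound on the first row leaves three columns.\<close>

lemma word_of_chain:
  assumes "c 0 = (\<lambda>r. 0)" and "\<And>i. i < N \<Longrightarrow> \<exists>r. c (Suc i) = add_box r (c i)"
    and "\<And>i r. i \<le> N \<Longrightarrow> c i (Suc r) \<le> c i r" and "c N 0 \<le> 3"
  shows "\<exists>w. length w = N \<and> ballot w \<and> (\<forall>i\<le>N. shape (take i w) = c i)"
  using assms(2-)
proof (induction N)
  case 0
  then show ?case using assms(1) by (simp add: ballot_def)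
next
  case (Suc N)
  obtain r where r: "c (Suc N) = add_box r (c N)"
    using Suc.prems(1) by blast
  have "c N 0 \<le> c (Suc N) 0"
    unfolding r by (simp add: add_box_def)
  then obtain w where w: "length w = N" "ballot w" "\<And>i. i \<le> N \<Longrightarrow> shape (take i w) = c i"
    using Suc by (metis le_SucI less_SucI order_trans)
  have shape_w: "shape w = c N"
    using w(3)[of N] w(1) by simp
  have "add_box r (shape w) r \<le> add_box r (shape w) 0"
    using lift_Suc_antimono_le[of "c (Suc N)" 0 r] Suc.prems(2)[of "Suc N"] unfolding r shape_w by simp
  then have less: "shape w r < 3"
    using Suc.prems(3) unfolding r shape_w by (simp add: add_box_def)
  \<comment> \<open>The new shape is a partition, so in the old shape the row above is strictly
    longer. Hence the column that takes the box ends exactly at row \<open>r\<close>.\<close>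
  have prev: "shape w r < shape w q" if "r = Suc q" for q
    using Suc.prems(2)[of "Suc N" q] that unfolding r shape_w[symmetric] by (simp add: add_box_def)
  have "\<exists>a. count_list w a = r \<and> ballot (w @ [a])"
  proof -
    have bounds: "count_list w Flat \<le> count_list w Up" "count_list w Down \<le> count_list w Flat"
      using ballot_counts[OF w(2)] by auto
    consider "count_list w Up \<le> r" | "count_list w Flat \<le> r" "r < count_list w Up"
      | "count_list w Down \<le> r" "r < count_list w Flat"
      using less shape_ballot[OF w(2), of r] by (auto split: if_splits)
    then show ?thesis
    proof cases
      case 1
      then have "count_list w Up = r"
        using prev bounds by (cases r) (auto simp: shape_ballot[OF w(2)] split: if_splits)
      then show ?thesis
        using bounds w(2) by (intro exI[of _ Up]) (simp add: ballot_snoc)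
    next
      case 2
      then have "count_list w Flat = r"
        using prev bounds by (cases r) (auto simp: shape_ballot[OF w(2)] split: if_splits)
      then show ?thesis
        using 2 bounds w(2) by (intro exI[of _ Flat]) (simp add: ballot_snoc)
    next
      case 3
      then have "count_list w Down = r"
        using prev bounds by (cases r) (auto simp: shape_ballot[OF w(2)] split: if_splits)
      then show ?thesis
        using 3 bounds w(2) by (intro exI[of _ Down]) (simp add: ballot_snoc)
    qed
  qed
  then obtain a where a: "count_list w a = r" "ballot (w @ [a])" by blast
  have "shape (take i (w @ [a])) = c i" if "i \<le> Suc N" for i
    using that w a r shape_w by (cases "i = Suc N") (auto simp: shape_snoc)
  then show ?case
    using w(1) a(2) by (intro exI[of _ "w @ [a]"]) auto
qed

text \<open>After adding \<open>a\<close>, a column weakly to the left is at least as tall as that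
  of \<open>a\<close>, so its next box is strictly lower. A column to the right must not become
  taller, so its next box is not lower.\<close>

lemma count_less_iff_level_le:
  assumes "ballot (w @ [a])" "ballot (w @ [a, b])"
  shows "count_list w a < count_list (w @ [a]) b \<longleftrightarrow> level b \<le> level a"
  using ballot_counts[OF assms(1)] ballot_counts[OF assms(2)] by (cases a; cases b) auto

section \<open>Encoding 1234-avoiding involutions by ballot words\<close>

lemma avoids_increasing_iff:
  "avoids N \<pi> [1, 2, 3, 4] \<longleftrightarrow> \<not> (\<exists>S\<subseteq>{1..N}. card S = 4 \<and> strict_mono_on S \<pi>)"
proof -
  have nth: "[1, 2, 3, 4 :: nat] ! a < [1, 2, 3, 4] ! b \<longleftrightarrow> a < b" if "a < 4" "b < 4" for a b
    using that by (auto simp: less_Suc_eq numeral_eq_Suc)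
  have len: "length [1, 2, 3, 4 :: nat] = 4" by simp
  have "(\<forall>a<4. \<forall>b<4. \<pi> (f a) < \<pi> (f b) \<longleftrightarrow> [1, 2, 3, 4 :: nat] ! a < [1, 2, 3, 4] ! b)
      \<longleftrightarrow> (\<forall>a<4. \<forall>b<4. \<pi> (f a) < \<pi> (f b) \<longleftrightarrow> a < b)" for f
    using nth by blast
  then have avoids: "avoids N \<pi> [1, 2, 3, 4] \<longleftrightarrow> \<not> (\<exists>f. strict_mono_on {..<4 :: nat} f \<and> f ` {..<4} \<subseteq> {1..N} \<and>
      (\<forall>a<4. \<forall>b<4. \<pi> (f a) < \<pi> (f b) \<longleftrightarrow> a < b))"
    by (simp only: avoids_def len)
  have "(\<exists>f. strict_mono_on {..<4 :: nat} f \<and> f ` {..<4} \<subseteq> {1..N} \<and>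
      (\<forall>a<4. \<forall>b<4. \<pi> (f a) < \<pi> (f b) \<longleftrightarrow> a < b))
    \<longleftrightarrow> (\<exists>S\<subseteq>{1..N}. card S = 4 \<and> strict_mono_on S \<pi>)" (is "(\<exists>f. ?P f) \<longleftrightarrow> (\<exists>S\<subseteq>_. ?Q S)")
  proof
    assume "\<exists>f. ?P f"
    then obtain f where P: "?P f" ..
    then have f: "strict_mono_on {..<4 :: nat} f" "f ` {..<4} \<subseteq> {1..N}" by auto
    have less: "\<pi> (f a) < \<pi> (f b) \<longleftrightarrow> a < b" if "a < 4" "b < 4" for a b
      using P that by simp
    have "card (f ` {..<4 :: nat}) = 4"
      using card_image[OF strict_mono_on_imp_inj_on[OF f(1)]] by simp
    moreover have "strict_mono_on (f ` {..<4}) \<pi>"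
      by (rule strict_mono_onI) (auto simp: less strict_mono_on_less[OF f(1)])
    ultimately show "\<exists>S\<subseteq>{1..N}. ?Q S"
      using f(2) by blast
  next
    assume "\<exists>S\<subseteq>{1..N}. ?Q S"
    then obtain S where S: "S \<subseteq> {1..N}" "card S = 4" "strict_mono_on S \<pi>" by blast
    then have "finite S" by (meson finite_atLeastAtMost finite_subset)
    then obtain f where f: "bij_betw f {..<4 :: nat} S" "strict_mono_on {..<4} f"
      using ex_bij_betw_strict_mono_card[of S] S(2) by metis
    have mem: "f a \<in> S" if "a < 4" for a
      using bij_betwE[OF f(1)] that by auto
    have "\<pi> (f a) < \<pi> (f b)" if "a < b" "b < 4" for a b
      using S(3) f(2) mem[of a] mem[of b] that by (auto simp: strict_mono_on_def)
    then have "\<pi> (f a) < \<pi> (f b) \<longleftrightarrow> a < b" if "a < 4" "b < 4" for a b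
      using that by (metis linorder_neqE_nat order_less_asym order_less_irrefl)
    moreover have "f ` {..<4} \<subseteq> {1..N}"
      using mem S(1) by auto
    ultimately show "\<exists>f. ?P f"
      using f(2) by blast
  qed
  then show ?thesis by (simp only: avoids)
qed

text \<open>The shapes \<open>perm_growth \<pi> i N\<close> belong to the prefixes of
  \<open>\<pi>\<close>, so they form its recording tableau.\<close>

definition encodes :: "nat \<Rightarrow> (nat \<Rightarrow> nat) \<Rightarrow> motzkin_step list \<Rightarrow> bool" where
  "encodes N \<pi> w \<longleftrightarrow> (\<forall>i\<le>N. perm_growth \<pi> i N = shape (take i w))"

lemma permutes_interval:
  fixes N :: nat
  assumes "\<pi> permutes {1..N}"
  shows "inj \<pi>" "\<pi> 0 = 0" "p \<in> {1..N} \<Longrightarrow> \<pi> p \<in> {1..N}"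
proof -
  show "\<pi> 0 = 0" by (rule permutes_not_in[OF assms]) simp
qed (simp_all only: permutes_inj[OF assms] permutes_in_image[OF assms])

text \<open>Descents of a permutation are those of its recording tableau: the next box lies in a
  lower row, which for ballot words means a weakly smaller letter. Ascents thus become increasing
  pairs.\<close>

lemma encodes_reverse_alternating:
  assumes \<pi>: "\<pi> permutes {1..N}" and w: "length w = N" "ballot w" and enc: "encodes N \<pi> w"
  shows "reverse_alternating N \<pi> \<longleftrightarrow> zigzag w"
proof -
  have shape_Suc: "shape (take (Suc i) w) = add_box (count_list (take i w) (w ! i)) (shape (take i w))"
    if "i < N" for i
    using that w(1) by (simp add: take_Suc_conv_app_nth shape_snoc)
  have descent: "\<pi> (Suc (Suc i)) < \<pi> (Suc i) \<longleftrightarrow> level (w ! Suc i) \<le> level (w ! i)" if i: "Suc i < N" for i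
  proof -
    let ?v = "take i w"
    have take1: "take (Suc i) w = ?v @ [w ! i]"
      using i w(1) by (simp add: take_Suc_conv_app_nth)
    have take2: "take (Suc (Suc i)) w = ?v @ [w ! i, w ! Suc i]"
      using i w(1) by (simp add: take_Suc_conv_app_nth)
    have growth: "perm_growth \<pi> k N = shape (take k w)" if "k \<le> N" for k
      using enc that by (simp add: encodes_def)
    have "count_list ?v (w ! i) < count_list (?v @ [w ! i]) (w ! Suc i)
        \<longleftrightarrow> \<pi> (Suc (Suc i)) < \<pi> (Suc i)"
    proof (rule perm_growth_descent[where j = N])
      show "perm_growth \<pi> (Suc i) N = add_box (count_list ?v (w ! i)) (perm_growth \<pi> i N)"
        using i shape_Suc[of i] by (simp only: growth)
      show "perm_growth \<pi> (Suc (Suc i)) N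
          = add_box (count_list (?v @ [w ! i]) (w ! Suc i)) (perm_growth \<pi> (Suc i) N)"
        using i shape_Suc[of "Suc i"] by (simp add: growth take1)
    qed (use permutes_interval[OF \<pi>] i in auto)
    moreover have "ballot (?v @ [w ! i])" "ballot (?v @ [w ! i, w ! Suc i])"
      using ballot_take[OF w(2), of "Suc i"] ballot_take[OF w(2), of "Suc (Suc i)"]
      by (simp_all only: take1 take2)
    ultimately show ?thesis
      using count_less_iff_level_le by simp
  qed
  show ?thesis
  proof
    assume L: "reverse_alternating N \<pi>"
    show "zigzag w"
      unfolding zigzag_def
    proof (intro allI impI)
      fix i assume "Suc i < length w"
      then show "level (w ! i) < level (w ! Suc i) \<longleftrightarrow> odd i"
        using L descent[of i] w(1) by (auto simp: reverse_alternating_def dest!: spec[of _ "Suc i"])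
    qed
  next
    assume R: "zigzag w"
    show "reverse_alternating N \<pi>"
      unfolding reverse_alternating_def
    proof (intro allI impI)
      fix i assume "1 \<le> i \<and> i < N"
      then obtain k where "i = Suc k" "Suc k < N" by (cases i) auto
      then show "\<pi> (i + 1) < \<pi> i \<longleftrightarrow> odd i"
        using R descent[of k] w(1) by (auto simp: zigzag_def dest!: spec[of _ k])
    qed
  qed
qed

lemma avoids_increasing_iff_growth:
  assumes "\<pi> permutes {1..N}"
  shows "avoids N \<pi> [1, 2, 3, 4] \<longleftrightarrow> perm_growth \<pi> N N 0 \<le> 3"
proof -
  have "\<pi> ` S \<subseteq> {..N}" if "S \<subseteq> {1..N}" for S
    using that permutes_interval(3)[OF assms] by force
  then have "4 \<le> perm_growth \<pi> N N 0 \<longleftrightarrow> (\<exists>S\<subseteq>{1..N}. card S = 4 \<and> strict_mono_on S \<pi>)"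
    using schensted_first_row[OF permutes_interval(1,2)[OF assms], of 4 N N] by auto
  then show ?thesis
    unfolding avoids_increasing_iff by (auto simp flip: not_le)
qed

lemma encodes_functional:
  assumes "encodes N \<pi> v" "encodes N \<pi> w" "ballot v" "ballot w" "length v = N" "length w = N"
  shows "v = w"
  by (rule shape_inject) (use assms in \<open>auto simp: encodes_def\<close>)

text \<open>For an involution the diagram is symmetric, so the chain encoded by \<open>w\<close>
  gives both outer boundaries, and these determine the matrix.\<close>

lemma encodes_injective:
  assumes "\<pi> permutes {1..N}" "\<sigma> permutes {1..N}" "\<And>p. \<pi> (\<pi> p) = p" "\<And>p. \<sigma> (\<sigma> p) = p"
    and "encodes N \<pi> w" "encodes N \<sigma> w"
  shows "\<pi> = \<sigma>"
proof -
  have sym: "perm_growth \<tau> i j = perm_growth \<tau> j i" if "\<And>p. \<tau> (\<tau> p) = p" for \<tau> i j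
  proof -
    have "perm_matrix \<tau> = (\<lambda>p q. perm_matrix \<tau> q p)"
      using that by (auto simp: perm_matrix_def fun_eq_iff)
    then show ?thesis using growth_transpose[of "perm_matrix \<tau>" i j] by simp
  qed
  have eq: "perm_growth \<pi> i N = perm_growth \<sigma> i N" if "i \<le> N" for i
    using assms(5,6) that by (simp add: encodes_def)
  have "\<pi> p = \<sigma> p" if p: "p \<in> {1..N}" for p
  proof -
    have "perm_matrix \<pi> p (\<pi> p) = perm_matrix \<sigma> p (\<pi> p)"
    proof (rule growth_determined)
      show "perm_growth \<pi> N i = perm_growth \<sigma> N i" if "i \<le> N" for i
        using eq[OF that] sym[of \<pi>] sym[of \<sigma>] assms(3,4) by metis
    qed (use eq p permutes_interval(3)[OF assms(1)] in auto)
    then show ?thesis by (simp add: perm_matrix_def split: if_splits)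
  qed
  then show ?thesis
    using permutes_not_in[OF assms(1)] permutes_not_in[OF assms(2)] by (metis ext)
qed

lemma ex_encoding_word:
  assumes "\<pi> permutes {1..N}" "avoids N \<pi> [1, 2, 3, 4]"
  shows "\<exists>w. length w = N \<and> ballot w \<and> encodes N \<pi> w"
proof -
  have "\<exists>w. length w = N \<and> ballot w \<and> (\<forall>i\<le>N. shape (take i w) = perm_growth \<pi> i N)"
  proof (rule word_of_chain)
    show "\<exists>r. perm_growth \<pi> (Suc i) N = add_box r (perm_growth \<pi> i N)" if "i < N" for i
      using perm_growth_step[of \<pi> i N] permutes_interval(3)[OF assms(1), of "Suc i"] that by auto
    show "perm_growth \<pi> i N (Suc r) \<le> perm_growth \<pi> i N r" for i r
      using perm_growth_interlaces(1)[of \<pi> i N] unfolding interlaces_def by (metis order_trans)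
    show "perm_growth \<pi> N N 0 \<le> 3"
      by (rule iffD1[OF avoids_increasing_iff_growth[OF assms(1)] assms(2)])
  qed simp
  then show ?thesis by (auto simp: encodes_def)
qed

lemma ex_encoded_involution:
  assumes "length w = N" "ballot w"
  shows "\<exists>\<pi>. \<pi> permutes {1..N} \<and> (\<forall>p. \<pi> (\<pi> p) = p) \<and> avoids N \<pi> [1, 2, 3, 4] \<and> encodes N \<pi> w"
proof -
  obtain \<pi> where \<pi>: "\<pi> permutes {1..N}" "\<And>p. \<pi> (\<pi> p) = p"
    "\<And>i. i \<le> N \<Longrightarrow> perm_growth \<pi> i N = shape (take i w)"
  proof (rule involution_of_chain[of "\<lambda>i. shape (take i w)" N])
    show "\<exists>r. shape (take (Suc i) w) = add_box r (shape (take i w))" if "i < N" for i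
      using that assms(1) by (auto simp: take_Suc_conv_app_nth shape_snoc)
  qed (auto simp: shape_antimono)
  moreover have "perm_growth \<pi> N N 0 \<le> 3"
    using \<pi>(3)[of N] shape_le_3 by simp
  ultimately show ?thesis
    using avoids_increasing_iff_growth[OF \<pi>(1)] by (auto simp: encodes_def)
qed

lemma card_RAI_avoiding:
  "card (RAI_avoiding N [1, 2, 3, 4]) = card {w. length w = N \<and> ballot w \<and> zigzag w}"
proof -
  let ?A = "RAI_avoiding N [1, 2, 3, 4]" and ?W = "{w. length w = N \<and> ballot w \<and> zigzag w}"
  have A: "\<pi> \<in> ?A \<longleftrightarrow> \<pi> permutes {1..N} \<and> (\<forall>p. \<pi> (\<pi> p) = p) \<and> avoids N \<pi> [1, 2, 3, 4]
      \<and> reverse_alternating N \<pi>" for \<pi>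
    by (auto simp: RAI_avoiding_def RAI_def inv_eq_self_iff)
  have ex: "\<exists>w. w \<in> ?W \<and> encodes N \<pi> w" if "\<pi> \<in> ?A" for \<pi>
    using that ex_encoding_word[of \<pi> N] encodes_reverse_alternating[of \<pi> N] unfolding A by blast
  define f where "f \<pi> = (SOME w. w \<in> ?W \<and> encodes N \<pi> w)" for \<pi>
  have f: "f \<pi> \<in> ?W" "encodes N \<pi> (f \<pi>)" if "\<pi> \<in> ?A" for \<pi>
    using someI_ex[OF ex[OF that]] by (auto simp: f_def)
  have "bij_betw f ?A ?W"
    unfolding bij_betw_def
  proof (intro conjI inj_onI equalityI image_subsetI subsetI)
    fix \<pi> \<sigma> assume "\<pi> \<in> ?A" "\<sigma> \<in> ?A" "f \<pi> = f \<sigma>"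
    then show "\<pi> = \<sigma>"
      using f(2)[of \<pi>] f(2)[of \<sigma>] encodes_injective[of \<pi> N \<sigma> "f \<pi>"] unfolding A by metis
  next
    fix w assume w: "w \<in> ?W"
    then obtain \<pi> where \<pi>: "\<pi> permutes {1..N}" "\<forall>p. \<pi> (\<pi> p) = p" "avoids N \<pi> [1, 2, 3, 4]" "encodes N \<pi> w"
      using ex_encoded_involution[of w N] by blast
    then have "\<pi> \<in> ?A"
      using w encodes_reverse_alternating[of \<pi> N w] unfolding A by blast
    moreover from this have "f \<pi> = w"
      using f[of \<pi>] \<pi>(4) w encodes_functional[of N \<pi> "f \<pi>" w] by blast
    ultimately show "w \<in> f ` ?A" by blast
  qed (use f in blast)
  then show ?thesis by (rule bij_betw_same_card)
qed

subsection \<open>Counting zigzag words\<close>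

fun motzkin_from :: "nat \<Rightarrow> motzkin_step list \<Rightarrow> bool" where
  "motzkin_from h [] \<longleftrightarrow> h = 0"
| "motzkin_from h (Up # w) \<longleftrightarrow> motzkin_from (Suc h) w"
| "motzkin_from h (Flat # w) \<longleftrightarrow> motzkin_from h w"
| "motzkin_from h (Down # w) \<longleftrightarrow> h > 0 \<and> motzkin_from (h - 1) w"

text \<open>\<open>x\<close> and \<open>y\<close> are the leads of \<open>Up\<close> over
  \<open>Flat\<close> and of \<open>Flat\<close> over \<open>Down\<close>. In contrast to
  \<open>motzkin_from\<close>, the end is free.\<close>

fun ballot_from :: "nat \<Rightarrow> nat \<Rightarrow> motzkin_step list \<Rightarrow> bool" where
  "ballot_from x y [] \<longleftrightarrow> True"
| "ballot_from x y (Up # w) \<longleftrightarrow> ballot_from (Suc x) y w"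
| "ballot_from x y (Flat # w) \<longleftrightarrow> x > 0 \<and> ballot_from (x - 1) (Suc y) w"
| "ballot_from x y (Down # w) \<longleftrightarrow> y > 0 \<and> ballot_from x (y - 1) w"

lemma all_le_Suc_shift: "(\<forall>k\<le>Suc n. P k) \<longleftrightarrow> P 0 \<and> (\<forall>k\<le>n. P (Suc k))"
  by (metis Suc_le_mono le0 nat.exhaust)

lemma motzkin_from_iff:
  "motzkin_from h w \<longleftrightarrow> (\<forall>k\<le>length w. 0 \<le> int h + height (take k w)) \<and> int h + height w = 0"
proof (induction h w rule: motzkin_from.induct)
  case (4 h w)
  show ?case
  proof (cases h)
    case 0
    have "\<not> (\<forall>k\<le>length (Down # w). 0 \<le> int h + height (take k (Down # w)))"
      using 0 by (auto simp: height_def intro!: exI[of _ "Suc 0"])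
    then show ?thesis using 0 by simp
  next
    case (Suc l)
    then show ?thesis using 4 by (simp add: all_le_Suc_shift height_def)
  qed
qed (simp_all add: all_le_Suc_shift height_def ac_simps)

lemma motzkin_path_iff_motzkin_from: "motzkin_path w \<longleftrightarrow> motzkin_from 0 w"
  by (simp add: motzkin_from_iff motzkin_path_def)

lemma ballot_from_iff:
  "ballot_from x y w \<longleftrightarrow> (\<forall>k\<le>length w. count_list (take k w) Flat \<le> x + count_list (take k w) Up \<and>
     count_list (take k w) Down \<le> y + count_list (take k w) Flat)"
proof (induction x y w rule: ballot_from.induct)
  case (3 x y w)
  then show ?case by (cases x) (auto simp: all_le_Suc_shift)
next
  case (4 x y w)
  then show ?case by (cases y) (auto simp: all_le_Suc_shift)
qed (simp_all add: all_le_Suc_shift)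

lemma ballot_iff_ballot_from: "ballot w \<longleftrightarrow> ballot_from 0 0 w"
  by (simp add: ballot_from_iff ballot_def)

definition num_words :: "nat \<Rightarrow> (motzkin_step list \<Rightarrow> bool) \<Rightarrow> nat" where
  "num_words m P = card {w. length w = m \<and> P w}"

lemma num_words_0 [simp]: "num_words 0 P = of_bool (P [])"
proof -
  have "{w. length w = 0 \<and> P w} = (if P [] then {[]} else {})" by auto
  then show ?thesis by (simp add: num_words_def)
qed

lemma finite_steps: "finite {w :: motzkin_step list. length w = m \<and> P w}"
proof -
  have "(UNIV :: motzkin_step set) = {Up, Down, Flat}"
    using motzkin_step.exhaust by blast
  then have "finite (UNIV :: motzkin_step set)"
    by (metis finite.emptyI finite_insert)
  then have "finite {w :: motzkin_step list. set w \<subseteq> UNIV \<and> length w = m}"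
    by (rule finite_lists_length_eq)
  then show ?thesis by (rule rev_finite_subset) auto
qed

lemma num_words_Suc:
  "num_words (Suc m) P = num_words m (\<lambda>w. P (Up # w)) + num_words m (\<lambda>w. P (Flat # w)) + num_words m (\<lambda>w. P (Down # w))"
proof -
  let ?S = "\<lambda>a. (#) a ` {w. length w = m \<and> P (a # w)}"
  have "w \<in> {w. length w = Suc m \<and> P w} \<longleftrightarrow> w \<in> ?S Up \<union> ?S Flat \<union> ?S Down" for w
    by (cases w; cases "hd w") auto
  then have "{w. length w = Suc m \<and> P w} = ?S Up \<union> ?S Flat \<union> ?S Down" by blast
  moreover have "card (?S Up \<union> ?S Flat \<union> ?S Down) = card (?S Up) + card (?S Flat) + card (?S Down)"
    by (subst card_Un_disjoint; (subst card_Un_disjoint)?) (auto simp: finite_steps)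
  moreover have "card (?S a) = num_words m (\<lambda>w. P (a # w))" for a
    unfolding num_words_def by (rule card_image) auto
  ultimately show ?thesis by (simp add: num_words_def)
qed

lemma num_words_False [simp]: "num_words m (\<lambda>w. False) = 0"
  by (simp add: num_words_def)

lemma motzkin_eq_num_words: "motzkin (int m) = num_words m (motzkin_from 0)"
  by (simp add: motzkin_def num_words_def motzkin_path_iff_motzkin_from conj_commute)

section \<open>Ballot words as sums over Motzkin paths\<close>

lemma num_words_motzkin_from_Suc:
  "num_words (Suc m) (motzkin_from h) = num_words m (motzkin_from (Suc h)) + num_words m (motzkin_from h)
     + (case h of 0 \<Rightarrow> 0 | Suc k \<Rightarrow> num_words m (motzkin_from k))"
  by (simp add: num_words_Suc split: nat.split)

text \<open>The three-dimensional representation of SU(3) restricts to SU(2) as a two-dimensional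
  plus a trivial one. Tensoring with it gives the ballot moves on \<open>(x, y)\<close> before
  restriction and the Motzkin moves on heights after it, so the box sum commutes with one
  step.\<close>

lemma box_sum_step:
  fixes g :: "nat \<Rightarrow> nat"
  shows "(\<Sum>i<Suc x. \<Sum>j<Suc y. g (Suc (i + j)) + g (i + j) + (case i + j of 0 \<Rightarrow> 0 | Suc k \<Rightarrow> g k))
    = (\<Sum>i<Suc (Suc x). \<Sum>j<Suc y. g (i + j)) + (\<Sum>i<x. \<Sum>j<Suc (Suc y). g (i + j))
      + (\<Sum>i<Suc x. \<Sum>j<y. g (i + j))"
proof (induction x)
  case 0
  have "(\<Sum>j<Suc y. case j of 0 \<Rightarrow> 0 | Suc k \<Rightarrow> g k) = (\<Sum>j<y. g j)"
    by (subst sum.lessThan_Suc_shift) simp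
  then show ?case by (simp add: sum.distrib del: sum.lessThan_Suc) (simp add: sum.distrib)
next
  case (Suc x)
  \<comment> \<open>The sums over \<open>g (Suc (x + j))\<close> and \<open>g (x + j)\<close> are
    regrouped by moving \<open>g x\<close> from the latter to the former.\<close>
  have shift: "(\<Sum>j<Suc y. g (Suc (x + j))) + g x = (\<Sum>j<Suc (Suc y). g (x + j))"
    by (subst (2) sum.lessThan_Suc_shift) simp
  have "(\<Sum>j<Suc y. g (Suc (Suc (x + j))) + g (Suc (x + j)) + g (x + j))
      = (\<Sum>j<Suc y. g (Suc (Suc (x + j)))) + (\<Sum>j<Suc (Suc y). g (x + j)) + (\<Sum>j<y. g (Suc (x + j)))"
    by (simp add: sum.distrib)
  with Suc show ?case
    by (subst sum.lessThan_Suc, subst (4 6 8) sum.lessThan_Suc) simp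
qed

lemma num_words_ballot_from: "num_words m (ballot_from x y) = (\<Sum>i<Suc x. \<Sum>j<Suc y. num_words m (motzkin_from (i + j)))"
proof (induction m arbitrary: x y)
  case 0
  have inner: "(\<Sum>j<Suc y. of_bool (i = 0 \<and> j = 0)) = (of_bool (i = 0) :: nat)" for i :: nat
    by (subst sum.lessThan_Suc_shift) simp
  have outer: "(\<Sum>i<Suc x. of_bool (i = 0)) = (1 :: nat)"
    by (subst sum.lessThan_Suc_shift) simp
  have "num_words 0 (motzkin_from (i + j)) = of_bool (i = 0 \<and> j = 0)" for i j
    by simp
  then show ?case by (simp only: num_words_0 ballot_from.simps inner outer of_bool_eq)
next
  case (Suc m)
  have "num_words (Suc m) (ballot_from x y) = num_words m (ballot_from (Suc x) y) + (if 0 < x then num_words m (ballot_from (x - 1) (Suc y)) else 0)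
      + (if 0 < y then num_words m (ballot_from x (y - 1)) else 0)"
    by (simp add: num_words_Suc)
  also have "\<dots> = (\<Sum>i<Suc (Suc x). \<Sum>j<Suc y. num_words m (motzkin_from (i + j)))
      + (\<Sum>i<x. \<Sum>j<Suc (Suc y). num_words m (motzkin_from (i + j))) + (\<Sum>i<Suc x. \<Sum>j<y. num_words m (motzkin_from (i + j)))"
    unfolding Suc by (cases x; cases y) (simp_all del: sum.lessThan_Suc)
  also have "\<dots> = (\<Sum>i<Suc x. \<Sum>j<Suc y. num_words (Suc m) (motzkin_from (i + j)))"
    unfolding num_words_motzkin_from_Suc by (rule box_sum_step[symmetric])
  finally show ?case .
qed

text \<open>The box sum is symmetric in \<open>x\<close> and \<open>y\<close>, although the moves of
  the letters are not.\<close>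

lemma num_words_ballot_from_commute: "num_words m (ballot_from x y) = num_words m (ballot_from y x)"
  unfolding num_words_ballot_from by (subst sum.swap) (simp add: add.commute)

text \<open>The box sum meets the heights 0, 1, 2 with multiplicities 1, 2, 1, whereas two Motzkin
  steps from height 0 reach them in 2, 2, 1 ways.\<close>

lemma num_words_ballot_from_1_1: "num_words m (ballot_from 1 1) + num_words m (motzkin_from 0) = num_words (Suc (Suc m)) (motzkin_from 0)"
  by (simp add: num_words_ballot_from num_words_motzkin_from_Suc numeral_2_eq_2)

section \<open>Zigzag words as sequences of increasing pairs\<close>

lemma zigzag_Cons_Cons_Cons:
  "zigzag (a # b # c # w) \<longleftrightarrow> level b \<le> level a \<and> level b < level c \<and> zigzag (c # w)"
proof -
  have all: "(\<forall>i. P i) \<longleftrightarrow> P 0 \<and> P 1 \<and> (\<forall>i. P (Suc (Suc i)))" for P :: "nat \<Rightarrow> bool"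
    by (metis One_nat_def nat.exhaust)
  show ?thesis
    unfolding zigzag_def by (subst all) (auto simp: not_less)
qed

lemma zigzag_pair: "zigzag [a, b] \<longleftrightarrow> level b \<le> level a"
  by (auto simp: zigzag_def)

text \<open>
  The recursions below strip one increasing pair. After such a pair the last letter is not \<open>Up\<close>, so
  it does not restrict the next pair; it only matters for the final letter of the word.
\<close>

definition zigzag_motzkin :: "nat \<Rightarrow> motzkin_step \<Rightarrow> nat \<Rightarrow> nat" where
  "zigzag_motzkin m a h = num_words (Suc (2 * m)) (\<lambda>w. zigzag (a # w) \<and> motzkin_from h w)"

definition zigzag_ballot :: "nat \<Rightarrow> motzkin_step \<Rightarrow> nat \<Rightarrow> nat \<Rightarrow> nat" where
  "zigzag_ballot m a x y = num_words (Suc (2 * m)) (\<lambda>w. zigzag (a # w) \<and> ballot_from x y w)"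

lemma zigzag_motzkin_0:
  "zigzag_motzkin 0 Flat h = num_words 0 (motzkin_from h)" "zigzag_motzkin 0 Down h = num_words 1 (motzkin_from h)"
  by (auto simp: zigzag_motzkin_def num_words_Suc zigzag_pair)

text \<open>After \<open>Up\<close> the next pair must be \<open>Up Flat\<close> or
  \<open>Up Down\<close>; after another letter \<open>Flat Down\<close> is possible too. These
  change the height by 1, 0 and -1, and the second letter of the pair is passed on.\<close>

lemma zigzag_motzkin_Suc:
  "zigzag_motzkin (Suc m) Up h = zigzag_motzkin m Flat (Suc h) + zigzag_motzkin m Down h"
  "a \<noteq> Up \<Longrightarrow> zigzag_motzkin (Suc m) a h = zigzag_motzkin m Flat (Suc h) + zigzag_motzkin m Down h
     + (case h of 0 \<Rightarrow> 0 | Suc k \<Rightarrow> zigzag_motzkin m Down k)"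
  by (cases a; auto simp: zigzag_motzkin_def num_words_Suc[of "Suc _"] zigzag_Cons_Cons_Cons conj_ac cong: conj_cong split: nat.split)+

lemma zigzag_ballot_0:
  "zigzag_ballot 0 Flat x y = 1 + of_bool (0 < x)" "zigzag_ballot 0 Down x y = num_words 1 (ballot_from x y)"
  by (auto simp: zigzag_ballot_def num_words_Suc zigzag_pair)

text \<open>The pairs move \<open>(x, y)\<close> to \<open>(x, y + 1)\<close>,
  \<open>(x + 1, y - 1)\<close> and \<open>(x - 1, y)\<close>: the moves of single letters with the
  coordinates exchanged.\<close>

lemma zigzag_ballot_Suc:
  "zigzag_ballot (Suc m) Up x y = zigzag_ballot m Flat x (Suc y)
     + (case y of 0 \<Rightarrow> 0 | Suc l \<Rightarrow> zigzag_ballot m Down (Suc x) l)"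
  "a \<noteq> Up \<Longrightarrow> zigzag_ballot (Suc m) a x y = zigzag_ballot m Flat x (Suc y)
     + (case y of 0 \<Rightarrow> 0 | Suc l \<Rightarrow> zigzag_ballot m Down (Suc x) l)
     + (case x of 0 \<Rightarrow> 0 | Suc k \<Rightarrow> zigzag_ballot m Down k y)"
  by (cases a; auto simp: zigzag_ballot_def num_words_Suc[of "Suc _"] zigzag_Cons_Cons_Cons conj_ac cong: conj_cong split: nat.split)+

text \<open>The pairs act as Motzkin steps and the final letter as one more, which gives the paths
  of length \<open>m + 2\<close> from \<open>h\<close>. Excluded are those with a final
  \<open>Down\<close> after the pair \<open>Up Flat\<close>; these two steps cancel and leave a path
  of length \<open>m\<close>.\<close>

lemma zigzag_motzkin_eq:
  "a \<noteq> Up \<Longrightarrow> zigzag_motzkin (Suc m) a h + num_words m (motzkin_from h) = num_words (Suc (Suc m)) (motzkin_from h)"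
proof (induction m arbitrary: a h)
  case 0
  then show ?case
    by (auto simp: zigzag_motzkin_Suc zigzag_motzkin_0 num_words_motzkin_from_Suc simp del: num_words_0 split: nat.split)
      (auto simp: num_words_motzkin_from_Suc)
next
  case (Suc m)
  have "zigzag_motzkin (Suc (Suc m)) a h + num_words (Suc m) (motzkin_from h)
      = (zigzag_motzkin (Suc m) Flat (Suc h) + num_words m (motzkin_from (Suc h))) + (zigzag_motzkin (Suc m) Down h + num_words m (motzkin_from h))
        + (case h of 0 \<Rightarrow> 0 | Suc k \<Rightarrow> zigzag_motzkin (Suc m) Down k + num_words m (motzkin_from k))"
    using Suc.prems by (simp add: zigzag_motzkin_Suc(2)[of _ "Suc m"] num_words_motzkin_from_Suc[of m] split: nat.split)
  also have "\<dots> = num_words (Suc (Suc (Suc m))) (motzkin_from h)"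
    by (simp add: Suc.IH num_words_motzkin_from_Suc[of "Suc (Suc m)"] split: nat.split)
  finally show ?case .
qed

text \<open>The recursion by first letter, carried through the symmetry of \<open>x\<close> and
  \<open>y\<close>, takes the form of \<open>zigzag_ballot_Suc\<close>.\<close>

lemma num_words_ballot_from_Suc:
  "num_words (Suc m) (ballot_from x y) = num_words m (ballot_from x (Suc y)) + (case y of 0 \<Rightarrow> 0 | Suc l \<Rightarrow> num_words m (ballot_from (Suc x) l))
     + (case x of 0 \<Rightarrow> 0 | Suc k \<Rightarrow> num_words m (ballot_from k y))"
proof -
  have "num_words (Suc m) (ballot_from y x) = num_words m (ballot_from (Suc y) x) + (case y of 0 \<Rightarrow> 0 | Suc l \<Rightarrow> num_words m (ballot_from l (Suc x)))
     + (case x of 0 \<Rightarrow> 0 | Suc k \<Rightarrow> num_words m (ballot_from y k))"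
    by (simp add: num_words_Suc split: nat.split)
  then show ?thesis
    unfolding num_words_ballot_from_commute[of "Suc m" x y] num_words_ballot_from_commute[of m x "Suc y"]
      num_words_ballot_from_commute[of m "Suc x"] num_words_ballot_from_commute[of m _ y] .
qed

text \<open>Again a final \<open>Down\<close> after the pair \<open>Up Flat\<close> is excluded. As
  this pair raises \<open>y\<close>, \<open>ballot_from\<close> would always admit that
  \<open>Down\<close>, so each choice of the first \<open>m\<close> pairs is subtracted
  once.\<close>

lemma zigzag_ballot_eq:
  "a \<noteq> Up \<Longrightarrow> zigzag_ballot (Suc m) a x y + num_words m (ballot_from x y) = num_words (Suc (Suc m)) (ballot_from x y)"
proof (induction m arbitrary: a x y)
  case 0
  have "Suc (zigzag_ballot 0 Flat x (Suc y)) = num_words (Suc 0) (ballot_from x (Suc y))" for x y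
    by (auto simp: zigzag_ballot_0 num_words_Suc)
  with 0 show ?case
    by (simp add: zigzag_ballot_Suc zigzag_ballot_0(2) num_words_ballot_from_Suc[of "Suc 0"] split: nat.split)
next
  case (Suc m)
  have "zigzag_ballot (Suc (Suc m)) a x y + num_words (Suc m) (ballot_from x y)
      = (zigzag_ballot (Suc m) Flat x (Suc y) + num_words m (ballot_from x (Suc y)))
        + (case y of 0 \<Rightarrow> 0 | Suc l \<Rightarrow> zigzag_ballot (Suc m) Down (Suc x) l + num_words m (ballot_from (Suc x) l))
        + (case x of 0 \<Rightarrow> 0 | Suc k \<Rightarrow> zigzag_ballot (Suc m) Down k y + num_words m (ballot_from k y))"
    using Suc.prems by (simp add: zigzag_ballot_Suc(2)[of _ "Suc m"] num_words_ballot_from_Suc[of m] split: nat.split)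
  also have "\<dots> = num_words (Suc (Suc (Suc m))) (ballot_from x y)"
    by (simp add: Suc.IH num_words_ballot_from_Suc[of "Suc (Suc m)"] split: nat.split)
  finally show ?case .
qed

text \<open>At height 0 the word starts with \<open>Up\<close> or \<open>Flat\<close>. The former
  forces the first pair to be \<open>Up Flat\<close> or \<open>Up Down\<close>, whence the first two
  terms.\<close>

lemma num_words_zigzag_motzkin:
  "num_words (2 * Suc (Suc m)) (\<lambda>w. zigzag w \<and> motzkin_from 0 w)
    = zigzag_motzkin m Flat 2 + zigzag_motzkin m Down 1 + zigzag_motzkin (Suc m) Flat 0"
proof -
  have double: "2 * Suc (Suc m) = Suc (Suc (2 * Suc m))" by simp
  have "num_words (2 * Suc (Suc m)) (\<lambda>w. zigzag w \<and> motzkin_from 0 w)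
      = zigzag_motzkin (Suc m) Up 1 + zigzag_motzkin (Suc m) Flat 0"
    unfolding double num_words_Suc[of "Suc (2 * Suc m)"] zigzag_motzkin_def by simp
  then show ?thesis by (simp add: zigzag_motzkin_Suc numeral_2_eq_2)
qed

text \<open>The first letter is \<open>Up\<close>, leading to \<open>(1, 0)\<close>, so the first
  pair starts with \<open>Up\<close>. As \<open>y\<close> is still 0, \<open>Up Down\<close> fails
  and only \<open>Up Flat\<close> remains.\<close>

lemma num_words_zigzag_ballot:
  "num_words (2 * Suc (Suc m)) (\<lambda>w. zigzag w \<and> ballot_from 0 0 w) = zigzag_ballot m Flat 1 1"
proof -
  have double: "2 * Suc (Suc m) = Suc (Suc (2 * Suc m))" by simp
  have "num_words (2 * Suc (Suc m)) (\<lambda>w. zigzag w \<and> ballot_from 0 0 w) = zigzag_ballot (Suc m) Up 1 0"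
    unfolding double num_words_Suc[of "Suc (2 * Suc m)"] zigzag_ballot_def by simp
  then show ?thesis by (simp add: zigzag_ballot_Suc)
qed

lemma motzkin_negative: "k < 0 \<Longrightarrow> motzkin k = 0"
proof -
  assume "k < 0"
  then have "{w. motzkin_path w \<and> int (length w) = k} = {}" by auto
  then show ?thesis by (simp only: motzkin_def card.empty)
qed

lemma num_words_zigzag_motzkin_eq:
  assumes "n \<ge> 2"
  shows "int (num_words (2 * n) (\<lambda>w. zigzag w \<and> motzkin_from 0 w))
    = int (motzkin (int n + 1)) - 2 * int (motzkin (int n - 1)) + int (motzkin (int n - 3))"
proof -
  obtain m where m: "n = Suc (Suc m)"
    using assms by (metis One_nat_def Suc_1 Suc_le_D Suc_le_mono)
  have motzkin: "motzkin (int n + 1) = num_words (Suc n) (motzkin_from 0)" "motzkin (int n - 1) = num_words (Suc m) (motzkin_from 0)"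
    using motzkin_eq_num_words[of "Suc n"] motzkin_eq_num_words[of "Suc m"] by (simp_all add: m ac_simps)
  show ?thesis
  proof (cases m)
    \<comment> \<open>For \<open>n = 2\<close> the index \<open>n - 3\<close> is negative, and
      \<open>zigzag_motzkin_eq\<close>, which needs a remaining pair, is replaced by direct
      evaluation.\<close>
    case 0
    then show ?thesis
      unfolding motzkin unfolding m num_words_zigzag_motzkin
      by (simp add: motzkin_negative zigzag_motzkin_Suc zigzag_motzkin_0 num_words_motzkin_from_Suc)
  next
    case (Suc k)
    have motzkin_3: "motzkin (int n - 3) = num_words k (motzkin_from 0)"
      using motzkin_eq_num_words[of k] by (simp add: m Suc)
    show ?thesis
      unfolding motzkin motzkin_3 unfolding m num_words_zigzag_motzkin Suc
      using zigzag_motzkin_eq[of Flat k 2] zigzag_motzkin_eq[of Down k 1] zigzag_motzkin_eq[of Flat "Suc k" 0]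
      by (simp add: num_words_motzkin_from_Suc numeral_2_eq_2)
  qed
qed

text \<open>A double difference: \<open>zigzag_ballot_eq\<close> gives a difference of ballot counts
  for lengths two apart, and \<open>num_words_ballot_from_1_1\<close> turns each into a difference
  of Motzkin numbers two apart.\<close>

lemma num_words_zigzag_ballot_eq:
  assumes "n \<ge> 2"
  shows "int (num_words (2 * n) (\<lambda>w. zigzag w \<and> ballot_from 0 0 w))
    = int (motzkin (int n + 1)) - 2 * int (motzkin (int n - 1)) + int (motzkin (int n - 3))"
proof -
  obtain m where m: "n = Suc (Suc m)"
    using assms by (metis One_nat_def Suc_1 Suc_le_D Suc_le_mono)
  have motzkin: "motzkin (int n + 1) = num_words (Suc n) (motzkin_from 0)" "motzkin (int n - 1) = num_words (Suc m) (motzkin_from 0)"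
    using motzkin_eq_num_words[of "Suc n"] motzkin_eq_num_words[of "Suc m"] by (simp_all add: m ac_simps)
  show ?thesis
  proof (cases m)
    case 0
    then show ?thesis
      unfolding motzkin unfolding m num_words_zigzag_ballot
      by (simp add: motzkin_negative zigzag_ballot_0 num_words_motzkin_from_Suc)
  next
    case (Suc k)
    have motzkin_3: "motzkin (int n - 3) = num_words k (motzkin_from 0)"
      using motzkin_eq_num_words[of k] by (simp add: m Suc)
    show ?thesis
      unfolding motzkin motzkin_3 unfolding m num_words_zigzag_ballot Suc
      using zigzag_ballot_eq[of Flat k 1 1] num_words_ballot_from_1_1[of k] num_words_ballot_from_1_1[of "Suc (Suc k)"] by simp
  qed
qed

theorem theorem5p7:
  fixes n :: nat
  assumes "n \<ge> 2"
  shows "card (RAI_avoiding (2 * n) [1, 2, 3, 4]) = card (AI_avoiding (2 * n) [4, 3, 2, 1]) \<and>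
         int (card (AI_avoiding (2 * n) [4, 3, 2, 1])) =
           int (motzkin (int n + 1)) - 2 * int (motzkin (int n - 1)) + int (motzkin (int n - 3))"
proof -
  have "card (RAI_avoiding (2 * n) [1, 2, 3, 4]) = num_words (2 * n) (\<lambda>w. zigzag w \<and> ballot_from 0 0 w)"
    unfolding card_RAI_avoiding num_words_def by (simp only: ballot_iff_ballot_from conj_commute)
  moreover have "card (AI_avoiding (2 * n) [4, 3, 2, 1]) = num_words (2 * n) (\<lambda>w. zigzag w \<and> motzkin_from 0 w)"
    unfolding card_AI_avoiding num_words_def by (simp only: motzkin_path_iff_motzkin_from conj_commute)
  ultimately show ?thesis
    using num_words_zigzag_motzkin_eq[OF assms] num_words_zigzag_ballot_eq[OF assms] by linarith
qed

end
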